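(* Let $d$ be a fixed positive integer and $\varepsilon>0$. The maximum number of unit volume $d$-simplices formed by $n$ points in $\mathbb{R}^d$ is $$O(n f_d(n))=O_{d,\varepsilon}\left(n^{d+1-\frac{d}{d^2-d+1}+\varepsilon}\right).$$
   Context: $f_d(n)$ denotes the maximum number of unit $d\times d$ minors (i.e. $d\times d$ minors equal to $1$) in a real $d\times n$ matrix without repeated columns. A $d$-simplex formed by a set of points is one whose $d+1$ vertices belong to the set; volume is normalized so that the simplex with vertices $0,v_1,\dots,v_d$ has unit volume if and only if $\det(v_1,\dots,v_d)=\pm1$. The subscripts of $O$ indicate what the implied constant depends on. *)

theory Defs
  imports
    Complex_Main
    "Jordan_Normal_Form.Determinant"
    "Jordan_Normal_Form.DL_Submatrix"
begin

text \<open>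
  Dimensions are carried by vectors and matrices explicitly, since the implied constant in
  \<open>O(n f\<^sub>d(n))\<close> must not depend on \<open>d\<close>, so that \<open>d\<close> is quantified inside the statement.
\<close>

text \<open>
  A maximal minor is identified with its set \<open>J\<close> of columns; the columns are taken in the order
  in which they occur in the matrix, so the sign of the minor is significant.
\<close>

definition unit_minors :: "real mat \<Rightarrow> nat set set" where
  "unit_minors A =
     {J. J \<subseteq> {..<dim_col A} \<and> card J = dim_row A \<and> det (submatrix A UNIV J) = 1}"

definition max_unit_minors :: "nat \<Rightarrow> nat \<Rightarrow> nat" where
  "max_unit_minors d n =
     Max {card (unit_minors A) | A. A \<in> carrier_mat d n \<and> distinct (cols A)}"

text \<open>
  Volume of the simplex with vertices \<open>p\<^sub>0, \<dots>, p\<^sub>d\<close>, normalized to be \<open>d!\<close> times the Lebesgue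
  measure.
\<close>

definition simplex_volume :: "nat \<Rightarrow> real vec list \<Rightarrow> real" where
  "simplex_volume d ps = \<bar>det (mat_of_cols d (map (\<lambda>p. p - hd ps) (tl ps)))\<bar>"

text \<open>
  A simplex is identified with its vertex set \<open>T\<close>. Its volume does not depend on the
  enumeration \<open>ps\<close> of the vertices.
\<close>

definition unit_simplices :: "nat \<Rightarrow> real vec set \<Rightarrow> real vec set set" where
  "unit_simplices d P =
     {T. T \<subseteq> P \<and> card T = d + 1 \<and>
         (\<exists>ps. distinct ps \<and> set ps = T \<and> simplex_volume d ps = 1)}"

definition max_unit_simplices :: "nat \<Rightarrow> nat \<Rightarrow> nat" where
  "max_unit_simplices d n =
     Max {card (unit_simplices d P) | P. P \<subseteq> carrier_vec d \<and> finite P \<and> card P = n}"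

text \<open>For \<open>d > 0\<close> both maxima range over finite nonempty sets.\<close>

lemma max_unit_minors_finite:
  "finite {card (unit_minors A) | A. A \<in> carrier_mat d n \<and> distinct (cols A)}"
proof (rule finite_subset)
  show "{card (unit_minors A) | A. A \<in> carrier_mat d n \<and> distinct (cols A)} \<subseteq> {..2 ^ n}"
  proof clarsimp
    fix A :: "real mat" assume A: "A \<in> carrier_mat d n"
    have "card (unit_minors A) \<le> card (Pow {..<n})"
      using A by (intro card_mono) (auto simp: unit_minors_def)
    then show "card (unit_minors A) \<le> 2 ^ n" by (simp add: card_Pow)
  qed
qed simp

lemma max_unit_minors_nonempty:
  assumes "d > 0"
  shows "{card (unit_minors A) | A. A \<in> carrier_mat d n \<and> distinct (cols A)} \<noteq> {}"
proof -
  let ?A = "mat d n (\<lambda>(i, j). real j)"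
  have first: "col ?A j $ 0 = real j" if "j < n" for j using that assms by simp
  have "inj_on (col ?A) {..<n}"
  proof (rule inj_onI)
    fix i j assume ij: "i \<in> {..<n}" "j \<in> {..<n}" and eq: "col ?A i = col ?A j"
    have "real i = col ?A i $ 0" using first ij by (metis lessThan_iff)
    also have "\<dots> = col ?A j $ 0" unfolding eq by (rule refl)
    also have "\<dots> = real j" using first ij by (metis lessThan_iff)
    finally show "i = j" by (rule of_nat_eq_iff[THEN iffD1])
  qed
  then have "distinct (cols ?A)"
    by (simp add: cols_def distinct_map atLeast0LessThan)
  moreover have "?A \<in> carrier_mat d n" by simp
  ultimately show ?thesis by blast
qed

lemma max_unit_simplices_finite:
  "finite {card (unit_simplices d P) | P. P \<subseteq> carrier_vec d \<and> finite P \<and> card P = n}"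
proof (rule finite_subset)
  show "{card (unit_simplices d P) | P. P \<subseteq> carrier_vec d \<and> finite P \<and> card P = n} \<subseteq> {..2 ^ n}"
  proof clarsimp
    fix P :: "real vec set" assume P: "finite P"
    have "card (unit_simplices d P) \<le> card (Pow P)"
      using P by (intro card_mono) (auto simp: unit_simplices_def)
    then show "card (unit_simplices d P) \<le> 2 ^ card P" using P by (simp add: card_Pow)
  qed
qed simp

lemma max_unit_simplices_nonempty:
  assumes "d > 0"
  shows "{card (unit_simplices d P) | P. P \<subseteq> carrier_vec d \<and> finite P \<and> card P = n} \<noteq> {}"
proof -
  let ?v = "\<lambda>j. vec d (\<lambda>_. real j)"
  have "inj_on ?v {..<n}"
  proof (rule inj_onI)
    fix i j assume "?v i = ?v j"
    then have "?v i $ 0 = ?v j $ 0" by (rule arg_cong)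
    then show "i = j" using assms by simp
  qed
  then have "card (?v ` {..<n}) = n" by (simp add: card_image)
  moreover have "?v ` {..<n} \<subseteq> carrier_vec d" by auto
  ultimately show ?thesis by blast
qed

end

theory Submission
  imports Defs
begin

text \<open>
  The unit simplices are reduced to unit minors by fixing one vertex: if \<open>p\<close> is a vertex of a unit
  simplex, the differences of the other vertices with \<open>p\<close> form a minor equal to \<open>1\<close> or \<open>-1\<close> of the matrix
  with columns \<open>q - p\<close>, so that there are at most \<open>2 n f\<^sub>d(n)\<close> unit simplices (\<open>max_unit_simplices_le\<close>).

  The number of unit minors is bounded by counting tuples of \<open>d\<close> vectors from an \<open>n\<close>-element set \<open>P\<close>
  whose determinant has a given nonzero value. By induction on \<open>d\<close> this number is
  \<open>O(n powr (d - 2 / (d + 1)))\<close> (\<open>det_tuples_bound\<close>), and the exponent is at most the one asserted since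
  \<open>(d - 1) (d - 2) \<ge> 0\<close>. For \<open>d = 1\<close> the tuple is determined by the determinant. For the induction step,
  fix the first vector \<open>u\<close> and project the others along \<open>u\<close>; the determinant becomes a multiple of a
  determinant of one size less, but several points may have the same projection. A point is called poor
  (for \<open>u\<close>) if the line through it parallel to \<open>u\<close> contains at most \<open>M\<close> points of \<open>P\<close>.

  If all remaining vectors of the tuple are poor, they can be counted by dividing the poor points into \<open>M\<close>
  classes of size at most about \<open>n / M\<close> on which the projection is injective (\<open>fibre_colouring\<close>), and by
  applying the induction hypothesis to each choice of classes. The saving over the trivial bound deteriorates only by a power of \<open>M\<close>.

  If some vector \<open>v\<close> of the tuple is on a rich line parallel to \<open>u\<close>, then \<open>u\<close> is determined by this line and
  the other vectors (\<open>same_fibre_same_determinant\<close>). The pair \<open>(u, v)\<close> thus contributes an incidence with a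
  rich line, and by the theorem of Szemeredi and Trotter there are only \<open>O(n\<^sup>2 / M\<^sup>2 + n)\<close> of them
  (\<open>rich_incidences_bound\<close>). The choice of \<open>M\<close> balances the two cases.

  The Szemeredi-Trotter bound is derived from the crossing lemma as in the work of Szekely. The
  crossing lemma follows by random sampling from a linear bound for the number of edges of a plane
  straight-line graph. For the latter a direct charging argument is used (\<open>plane_edge_bound\<close>):
  two edges that enter a vertex from the left and are consecutive there bound a wedge, and the wedge can be
  recovered from the rightmost vertex in it other than the apex.
\<close>

section \<open>Plane straight-line graphs\<close>

type_synonym point = "real \<times> real"

definition slope :: "point \<times> point \<Rightarrow> real" where
  "slope e = (snd (snd e) - snd (fst e)) / (fst (snd e) - fst (fst e))"

definition height :: "point \<times> point \<Rightarrow> real \<Rightarrow> real" where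
  "height e x = snd (snd e) + slope e * (x - fst (snd e))"

definition over :: "point \<times> point \<Rightarrow> real set" where
  "over e = {fst (fst e) <..< fst (snd e)}"

text \<open>
  Crossings are ordered pairs, so each unordered one is counted twice. Two edges that overlap in a
  segment also cross in this sense.
\<close>

definition crossings :: "(point \<times> point) set \<Rightarrow> ((point \<times> point) \<times> (point \<times> point)) set" where
  "crossings E = {(e, f). e \<in> E \<and> f \<in> E \<and> e \<noteq> f \<and>
     (\<exists>x \<in> over e \<inter> over f. height e x = height f x)}"

text \<open>
  Straight-line drawings in which no two vertices share an abscissa; every edge is oriented from left
  to right, so that it is the graph of an affine function over an interval.
\<close>

locale geometric_graph =
  fixes V :: "point set" and E :: "(point \<times> point) set"
  assumes finite_vertices: "finite V"
    and inj_fst: "inj_on fst V"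
    and edges_subset: "E \<subseteq> V \<times> V"
    and edge_rightwards: "e \<in> E \<Longrightarrow> fst (fst e) < fst (snd e)"
    and vertex_not_on_edge: "e \<in> E \<Longrightarrow> v \<in> V \<Longrightarrow> fst v \<in> over e \<Longrightarrow> snd v \<noteq> height e (fst v)"

lemma height_right [simp]: "height e (fst (snd e)) = snd (snd e)"
  by (simp add: height_def)

lemma height_left: "fst (fst e) < fst (snd e) \<Longrightarrow> height e (fst (fst e)) = snd (fst e)"
  by (simp add: height_def slope_def field_simps)

lemma height_less_common_right:
  assumes "snd e = snd g" "slope g < slope e" "x < fst (snd e)"
  shows "height e x < height g x"
proof -
  have "slope e * (x - fst (snd e)) < slope g * (x - fst (snd e))"
    using assms by (intro mult_strict_right_mono_neg) auto
  then show ?thesis using assms by (simp add: height_def)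
qed

lemma height_le_common_right:
  assumes "snd e = snd g" "slope g \<le> slope e" "x < fst (snd e)"
  shows "height e x \<le> height g x"
proof (cases "slope g = slope e")
  case True
  then show ?thesis using assms by (simp add: height_def)
next
  case False
  then show ?thesis using height_less_common_right[of e g x] assms by simp
qed

lemma heights_meet:
  assumes "x < y" "height e x < height f x" "height f y < height e y"
  shows "\<exists>z. x < z \<and> z < y \<and> height e z = height f z"
proof -
  let ?h = "\<lambda>z. height e z - height f z"
  have "\<exists>z\<ge>x. z \<le> y \<and> ?h z = 0"
    using assms by (intro IVT') (auto simp: height_def intro!: continuous_intros)
  then obtain z where z: "x \<le> z" "z \<le> y" "?h z = 0" by blast
  moreover have "z \<noteq> x" "z \<noteq> y" using z assms by auto
  ultimately show ?thesis by (intro exI[of _ z]) auto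
qed

context geometric_graph
begin

lemma finite_edges: "finite E"
  using edges_subset finite_vertices by (meson finite_SigmaI finite_subset)

lemma finite_crossings: "finite (crossings E)"
  by (rule finite_subset[of _ "E \<times> E"]) (auto simp: crossings_def finite_edges)

lemma ends_in: "e \<in> E \<Longrightarrow> fst e \<in> V" "e \<in> E \<Longrightarrow> snd e \<in> V"
  using edges_subset by (auto dest!: subsetD simp: mem_Times_iff)

lemma vertex_eqI: "v \<in> V \<Longrightarrow> w \<in> V \<Longrightarrow> fst v = fst w \<Longrightarrow> v = w"
  using inj_fst by (auto dest: inj_onD)

lemma vertex_at_left_end:
  assumes "e \<in> E" "v \<in> V" "fst (fst e) \<le> fst v" "fst v < fst (snd e)" "snd v = height e (fst v)"
  shows "v = fst e"
proof -
  have "fst v \<notin> over e" using vertex_not_on_edge[OF assms(1,2)] assms(5) by auto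
  then have "fst v = fst (fst e)" using assms by (auto simp: over_def)
  then show ?thesis using vertex_eqI ends_in assms by blast
qed

text \<open>
  The edges entering a vertex from the left are ordered by height; \<open>g\<close> is the next one above \<open>e\<close>, and
  the two bound a wedge whose apex is their common right end. The wedge is truncated on the left at
  the nearer of the two left ends, and \<open>q\<close> is the rightmost vertex in it apart from the apex. Seen from
  the apex, nothing happens in the wedge before \<open>q\<close>, and this makes \<open>q\<close> remember the wedge.
\<close>

definition wedge_tip :: "point \<times> point \<Rightarrow> point \<times> point \<Rightarrow> point \<Rightarrow> bool" where
  "wedge_tip e g q \<longleftrightarrow> e \<in> E \<and> g \<in> E \<and> snd g = snd e \<and> slope g < slope e \<and>
     (\<forall>h \<in> E. snd h = snd e \<and> slope h < slope e \<longrightarrow> slope h \<le> slope g) \<and>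
     q \<in> V \<and> fst q < fst (snd e) \<and> fst (fst e) \<le> fst q \<and> fst (fst g) \<le> fst q \<and>
     height e (fst q) \<le> snd q \<and> snd q \<le> height g (fst q) \<and>
     (\<forall>v \<in> V. fst q < fst v \<and> fst v < fst (snd e) \<longrightarrow>
        snd v < height e (fst v) \<or> height g (fst v) < snd v)"

lemma wedge_tip_exists:
  assumes e: "e \<in> E" and above: "\<exists>h\<in>E. snd h = snd e \<and> slope h < slope e"
  shows "\<exists>g q. wedge_tip e g q"
proof -
  let ?H = "{h \<in> E. snd h = snd e \<and> slope h < slope e}"
  have "finite ?H" using finite_edges by simp
  moreover have "?H \<noteq> {}" using above by blast
  ultimately obtain g where "is_arg_min (\<lambda>h. - slope h) (\<lambda>h. h \<in> ?H) g"
    using ex_is_arg_min_if_finite[of ?H "\<lambda>h. - slope h"] by blast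
  then have g: "g \<in> E" "snd g = snd e" "slope g < slope e"
    and "\<And>h. h \<in> ?H \<Longrightarrow> - slope g \<le> - slope h"
    unfolding is_arg_min_linorder by blast+
  then have gmax: "slope h \<le> slope g" if "h \<in> E" "snd h = snd e" "slope h < slope e" for h
    using that by simp
  let ?W = "{v \<in> V. fst v < fst (snd e) \<and> fst (fst e) \<le> fst v \<and> fst (fst g) \<le> fst v \<and>
     height e (fst v) \<le> snd v \<and> snd v \<le> height g (fst v)}"
  have re: "fst (fst e) < fst (snd e)" and rg: "fst (fst g) < fst (snd g)"
    by (rule edge_rightwards[OF e] edge_rightwards[OF g(1)])+
  have le: "height e x \<le> height g x" if "x < fst (snd e)" for x
    using height_less_common_right[of e g x] g that by simp
  \<comment> \<open>The nearer left end lies in the truncated wedge, so there is a rightmost vertex to choose.\<close>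
  have "fst e \<in> ?W \<or> fst g \<in> ?W"
    using le[of "fst (fst e)"] le[of "fst (fst g)"] height_left[OF re] height_left[OF rg]
      ends_in e g re rg by auto
  then have "?W \<noteq> {}" by blast
  moreover have "finite ?W" using finite_vertices by simp
  ultimately obtain q where "is_arg_min (\<lambda>v. - fst v) (\<lambda>v. v \<in> ?W) q"
    using ex_is_arg_min_if_finite[of ?W "\<lambda>v. - fst v"] by blast
  then have q: "q \<in> ?W" and qmin: "\<And>v. v \<in> ?W \<Longrightarrow> - fst q \<le> - fst v"
    unfolding is_arg_min_linorder by blast+
  then have qmax: "fst v \<le> fst q" if "v \<in> ?W" for v
    using qmin[OF that] by simp
  have "snd v < height e (fst v) \<or> height g (fst v) < snd v"
    if "v \<in> V" "fst q < fst v" "fst v < fst (snd e)" for v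
  proof (rule ccontr)
    assume "\<not> ?thesis"
    then have "height e (fst v) \<le> snd v" "snd v \<le> height g (fst v)" by linarith+
    moreover have "fst (fst e) \<le> fst q" "fst (fst g) \<le> fst q" using q by blast+
    then have "fst (fst e) \<le> fst v" "fst (fst g) \<le> fst v" using that(2) by linarith+
    ultimately have "v \<in> ?W" using that(1,3) by blast
    then show False using qmax that(2) by (meson not_less)
  qed
  then have "wedge_tip e g q" unfolding wedge_tip_def using e g gmax q by blast
  then show ?thesis by blast
qed

context
  assumes plane: "crossings E = {}"
begin

lemma no_crossing:
  assumes "e \<in> E" "f \<in> E" "height e x = height f x"
    "fst (fst e) < x" "fst (fst f) < x" "x < fst (snd e)" "x < fst (snd f)"
  shows "e = f"
proof (rule ccontr)
  assume "e \<noteq> f"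
  moreover have "x \<in> over e \<inter> over f" using assms by (simp add: over_def)
  ultimately have "(e, f) \<in> crossings E" using assms unfolding crossings_def by blast
  then show False using plane by simp
qed

lemma slope_determines_edge:
  assumes "e \<in> E" "f \<in> E" "snd e = snd f" "slope e = slope f"
  shows "e = f"
proof -
  obtain x where "max (fst (fst e)) (fst (fst f)) < x" "x < fst (snd e)"
    using dense edge_rightwards assms by (metis max_less_iff_conj)
  then show ?thesis using assms by (intro no_crossing[of e f x]) (auto simp: height_def)
qed

text \<open>
  Suppose that \<open>q\<close> were the tip of two wedges with different apexes. The nearer apex lies
  over the farther wedge but to the right of its tip, hence outside it, say above it. The
  lower edge of the near wedge then starts below the upper edge of the far wedge and ends above it,
  so the two cross. The only escape is that both edges emanate from \<open>q\<close>, one as a lower and one as an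
  upper edge; recording whether \<open>q\<close> is the left end of the lower edge excludes this.
\<close>

lemma wedge_tip_right_end_le:
  assumes W: "wedge_tip e g q" and W': "wedge_tip e' g' q"
    and tag: "q = fst e \<longleftrightarrow> q = fst e'"
  shows "fst (snd e') \<le> fst (snd e)"
proof (rule ccontr)
  assume "\<not> ?thesis"
  then have less: "fst (snd e) < fst (snd e')" by simp
  note w = W[unfolded wedge_tip_def] and w' = W'[unfolded wedge_tip_def]
  have strict: "height e (fst q) < height g (fst q)" "height e' (fst q) < height g' (fst q)"
    using w w' by (auto intro!: height_less_common_right)
  have "snd (snd e) < height e' (fst (snd e)) \<or> height g' (fst (snd e)) < snd (snd e)"
    using w w' less ends_in by auto
  then show False
  proof
    assume 1: "height g' (fst (snd e)) < snd (snd e)"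
    show False
    proof (cases "height e (fst q) < height g' (fst q)")
      case True
      then obtain z where "fst q < z" "z < fst (snd e)" "height e z = height g' z"
        using heights_meet[of "fst q" "fst (snd e)" e g'] 1 w by auto
      then have "e = g'" using w w' less by (intro no_crossing[of e g' z]) auto
      then show False using True by simp
    next
      case False
      then have "height e (fst q) = snd q" using w w' by linarith
      then have "q = fst e" using w by (intro vertex_at_left_end) auto
      then have "q = fst e'" using tag by simp
      then have "height e' (fst q) = snd q" using height_left edge_rightwards w' by blast
      then show False using False strict w w' by linarith
    qed
  next
    assume 1: "snd (snd e) < height e' (fst (snd e))"
    show False
    proof (cases "height e' (fst q) < height g (fst q)")
      case True
      then obtain z where "fst q < z" "z < fst (snd e)" "height e' z = height g z"
        using heights_meet[of "fst q" "fst (snd e)" e' g] 1 w by (metis height_right)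
      then have "e' = g" using w w' less by (intro no_crossing[of e' g z]) auto
      then show False using True by simp
    next
      case False
      then have "height e' (fst q) = snd q" using w w' by linarith
      then have "q = fst e'" using w' by (intro vertex_at_left_end) auto
      then have "q = fst e" using tag by simp
      then have "height e (fst q) = snd q" using height_left edge_rightwards w by blast
      then show False using False strict w w' by linarith
    qed
  qed
qed

text \<open>
  Two different wedges at the same apex have disjoint interiors, so a common tip lies on the edge
  between them; it is then the left end of the lower edge of only one of them.
\<close>

lemma wedge_tip_slope_le:
  assumes W: "wedge_tip e g q" and W': "wedge_tip e' g' q"
    and tag: "q = fst e \<longleftrightarrow> q = fst e'" and same: "snd e = snd e'"
  shows "slope e \<le> slope e'"
proof (rule ccontr)
  note w = W[unfolded wedge_tip_def] and w' = W'[unfolded wedge_tip_def]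
  assume "\<not> ?thesis"
  then have "slope e' \<le> slope g" using w w' same by auto
  then have "height g (fst q) \<le> height e' (fst q)"
    using w w' same by (intro height_le_common_right) auto
  then have eq: "height e' (fst q) = snd q" "height g (fst q) = snd q" using w w' by linarith+
  then have "q = fst e'" using w' by (intro vertex_at_left_end) auto
  then have "q = fst e" using tag by simp
  then have "height e (fst q) = snd q" using height_left edge_rightwards w by blast
  moreover have "height e (fst q) < height g (fst q)"
    using w by (auto intro!: height_less_common_right)
  ultimately show False using eq by simp
qed

text \<open>
  The planar bound without Euler's formula. An edge that is the topmost one entering its right end is
  charged to that end; every other edge is charged to the tip of the wedge above it, together with one
  bit. Each vertex is charged at most three times.
\<close>

lemma plane_edge_bound: "card E \<le> 3 * card V"
proof -
  define top where "top e \<longleftrightarrow> \<not> (\<exists>h\<in>E. snd h = snd e \<and> slope h < slope e)" for e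
  have "\<forall>e\<in>{e\<in>E. \<not> top e}. \<exists>q. \<exists>g. wedge_tip e g q"
    using wedge_tip_exists unfolding top_def by blast
  then obtain tip where tip: "\<And>e. e \<in> E \<Longrightarrow> \<not> top e \<Longrightarrow> \<exists>g. wedge_tip e g (tip e)"
    by (metis (mono_tags, lifting) mem_Collect_eq)
  define c where "c e = (if top e then (snd e, 0::nat) else (tip e, if tip e = fst e then 1 else 2))" for e
  have "inj_on c E"
  proof (rule inj_onI)
    fix e f assume e: "e \<in> E" and f: "f \<in> E" and eq: "c e = c f"
    consider "top e" "top f" | "\<not> top e" "\<not> top f"
      using eq by (auto simp: c_def split: if_splits)
    then show "e = f"
    proof cases
      case 1
      then have "snd e = snd f" using eq by (simp add: c_def)
      moreover from this have "slope e = slope f"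
        using 1 e f unfolding top_def by (metis linorder_neqE_linordered_idom)
      ultimately show ?thesis using slope_determines_edge e f by blast
    next
      case 2
      then have q: "tip f = tip e" and tag: "tip e = fst e \<longleftrightarrow> tip e = fst f"
        using eq by (auto simp: c_def split: if_splits)
      obtain g g' where W: "wedge_tip e g (tip e)" "wedge_tip f g' (tip e)"
        using tip e f 2 q by metis
      have "fst (snd e) = fst (snd f)"
        using wedge_tip_right_end_le[OF W tag] wedge_tip_right_end_le[OF W(2,1) tag[symmetric]]
        by simp
      then have same: "snd e = snd f" using vertex_eqI ends_in e f by blast
      have "slope e = slope f"
        using wedge_tip_slope_le[OF W tag same]
          wedge_tip_slope_le[OF W(2,1) tag[symmetric] same[symmetric]] by simp
      then show ?thesis using slope_determines_edge e f same by blast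
    qed
  qed
  moreover have "c ` E \<subseteq> V \<times> {0, 1, 2}"
  proof (rule image_subsetI)
    fix e assume e: "e \<in> E"
    show "c e \<in> V \<times> {0, 1, 2}"
    proof (cases "top e")
      case True
      then show ?thesis using ends_in e by (auto simp: c_def)
    next
      case False
      then obtain g where "wedge_tip e g (tip e)" using tip e by blast
      then show ?thesis using False by (auto simp: c_def wedge_tip_def)
    qed
  qed
  ultimately have "card E \<le> card (V \<times> {0::nat, 1, 2})"
    using finite_vertices by (intro card_inj_on_le) auto
  then show ?thesis by (simp add: card_cartesian_product)
qed

end
end

section \<open>The crossing lemma\<close>

context geometric_graph
begin

lemma geometric_graph_induced:
  assumes "S \<subseteq> V" "F \<subseteq> E \<inter> S \<times> S"
  shows "geometric_graph S F"
proof
  show "finite S" "inj_on fst S" using assms finite_vertices inj_fst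
    by (auto intro: finite_subset inj_on_subset)
  show "F \<subseteq> S \<times> S" using assms by blast
  fix e assume e: "e \<in> F"
  then show "fst (fst e) < fst (snd e)" using assms edge_rightwards by blast
  show "snd v \<noteq> height e (fst v)" if "v \<in> S" "fst v \<in> over e" for v
    using that e assms vertex_not_on_edge by blast
qed

lemma crossings_subset: "crossings F \<subseteq> F \<times> F"
  by (auto simp: crossings_def)

text \<open>
  Deleting one edge from every crossing leaves a plane graph.
\<close>

lemma edge_bound_crossings: "card E \<le> 3 * card V + card (crossings E)"
proof -
  let ?F = "E - fst ` crossings E"
  interpret F: geometric_graph V ?F
    using edges_subset by (intro geometric_graph_induced) blast+
  have "False" if c: "c \<in> crossings ?F" for c
  proof -
    have "c \<in> crossings E" using c unfolding crossings_def by blast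
    then have "fst c \<in> fst ` crossings E" by (rule imageI)
    moreover have "c \<in> ?F \<times> ?F" by (rule subsetD[OF crossings_subset c])
    then have "fst c \<in> ?F" by (rule mem_Times_iff[THEN iffD1, THEN conjunct1])
    ultimately show False by blast
  qed
  then have "crossings ?F = {}" by blast
  then have "card ?F \<le> 3 * card V" by (rule F.plane_edge_bound)
  moreover have "card E - card (fst ` crossings E) \<le> card ?F"
    by (intro diff_card_le_card_Diff finite_imageI finite_crossings)
  moreover have "card (fst ` crossings E) \<le> card (crossings E)"
    by (rule card_image_le) (rule finite_crossings)
  ultimately show ?thesis by linarith
qed

lemma slopes_equal_common_point:
  assumes "height e x = height f x" "height e y = height f y" "x \<noteq> y"
  shows "height e z = height f z"
proof -
  have "(slope e - slope f) * (x - y) = 0"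
    using assms by (simp add: height_def algebra_simps)
  then have "slope e = slope f" using assms by simp
  then show ?thesis using assms by (simp add: height_def algebra_simps)
qed

text \<open>
  Two straight edges with a common end meet again only if they lie on the same line, and then the end
  of one of them would lie in the interior of the other.
\<close>

lemma crossing_edges_disjoint:
  assumes "(e, f) \<in> crossings E"
  shows "card {fst e, snd e, fst f, snd f} = 4"
proof -
  obtain x where e: "e \<in> E" and f: "f \<in> E" and ne: "e \<noteq> f" and x: "x \<in> over e" "x \<in> over f"
    and eq: "height e x = height f x"
    using assms by (auto simp: crossings_def)
  have ie: "fst (fst e) < x" "x < fst (snd e)" "fst (fst f) < x" "x < fst (snd f)"
    using x by (auto simp: over_def)
  note he = height_left[OF edge_rightwards[OF e]] and hf = height_left[OF edge_rightwards[OF f]]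
  have V: "fst e \<in> V" "snd e \<in> V" "fst f \<in> V" "snd f \<in> V" using ends_in e f by auto
  have "snd e \<noteq> snd f"
  proof
    assume s: "snd e = snd f"
    then have all: "height e z = height f z" for z
      using slopes_equal_common_point[OF eq, of "fst (snd e)"] ie height_right[of e] height_right[of f]
      by simp
    have "fst e \<noteq> fst f" using ne s by (simp add: prod_eq_iff)
    then have "fst (fst e) \<noteq> fst (fst f)" using V vertex_eqI by blast
    then consider "fst (fst e) < fst (fst f)" | "fst (fst f) < fst (fst e)" by linarith
    then show False
    proof cases
      case 1
      then have "fst (fst f) \<in> over e" using ie by (simp add: over_def)
      then show False using vertex_not_on_edge[OF e V(3)] hf all by simp
    next
      case 2
      then have "fst (fst e) \<in> over f" using ie by (simp add: over_def)
      then show False using vertex_not_on_edge[OF f V(1)] he all by simp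
    qed
  qed
  moreover have "fst e \<noteq> fst f"
  proof
    assume s: "fst e = fst f"
    then have all: "height e z = height f z" for z
      using slopes_equal_common_point[OF eq, of "fst (fst e)"] ie he hf by simp
    have "snd e \<noteq> snd f" using ne s by (simp add: prod_eq_iff)
    then have "fst (snd e) \<noteq> fst (snd f)" using V vertex_eqI by blast
    then consider "fst (snd e) < fst (snd f)" | "fst (snd f) < fst (snd e)" by linarith
    then show False
    proof cases
      case 1
      then have "fst (snd e) \<in> over f" using ie by (simp add: over_def)
      then show False using vertex_not_on_edge[OF f V(2)] all[of "fst (snd e)"] by simp
    next
      case 2
      then have "fst (snd f) \<in> over e" using ie by (simp add: over_def)
      then show False using vertex_not_on_edge[OF e V(4)] all[of "fst (snd f)"] by simp
    qed
  qed
  moreover have "fst e \<noteq> snd e" "fst e \<noteq> snd f" "fst f \<noteq> snd e" "fst f \<noteq> snd f"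
    using ie by auto
  ultimately show ?thesis by simp
qed

end

text \<open>
  For \<open>0 \<le> p \<le> 1\<close> this is the probability that a random subset of \<open>V\<close>, which contains each element
  independently with probability \<open>p\<close>, contains \<open>T\<close>.
\<close>

lemma sum_superset_weights:
  fixes p :: real
  assumes "finite V" "T \<subseteq> V"
  shows "(\<Sum>S | S \<subseteq> V \<and> T \<subseteq> S. p ^ card S * (1 - p) ^ card (V - S)) = p ^ card T"
proof -
  have fT: "finite T" using assms finite_subset by blast
  have "(\<Sum>S | S \<subseteq> V \<and> T \<subseteq> S. p ^ card S * (1 - p) ^ card (V - S))
      = (\<Sum>R \<in> Pow (V - T). p ^ card T * ((\<Prod>x\<in>R. p) * (\<Prod>x\<in>(V - T) - R. 1 - p)))"
  proof (rule sum.reindex_bij_witness[of _ "\<lambda>R. T \<union> R" "\<lambda>S. S - T"])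
    fix S assume "S \<in> {S. S \<subseteq> V \<and> T \<subseteq> S}"
    then have S: "S \<subseteq> V" "T \<subseteq> S" by auto
    have "card S = card T + card (S - T)"
      using S fT assms by (metis card_Diff_subset card_mono finite_subset le_add_diff_inverse)
    moreover have "V - T - (S - T) = V - S" using S by blast
    ultimately show "p ^ card T * ((\<Prod>x\<in>S - T. p) * (\<Prod>x\<in>V - T - (S - T). 1 - p))
        = p ^ card S * (1 - p) ^ card (V - S)"
      by (simp add: power_add)
  qed (use assms in auto)
  also have "\<dots> = p ^ card T * (\<Prod>x\<in>V - T. p + (1 - p))"
    unfolding sum_distrib_left[symmetric] using assms by (subst prod_add) auto
  finally show ?thesis by simp
qed

text \<open>
  The expected number of the sets \<open>T i\<close> that a random subset of \<open>V\<close> contains.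
\<close>

lemma sum_weighted_card:
  fixes p :: real
  assumes "finite V" "finite I" "\<And>i. i \<in> I \<Longrightarrow> T i \<subseteq> V" "\<And>i. i \<in> I \<Longrightarrow> card (T i) = k"
  shows "(\<Sum>S\<in>Pow V. p ^ card S * (1 - p) ^ card (V - S) * real (card {i\<in>I. T i \<subseteq> S}))
    = p ^ k * real (card I)"
proof -
  let ?w = "\<lambda>S. p ^ card S * (1 - p) ^ card (V - S)"
  have "(\<Sum>S\<in>Pow V. ?w S * real (card {i\<in>I. T i \<subseteq> S}))
      = (\<Sum>S\<in>Pow V. \<Sum>i\<in>I. if T i \<subseteq> S then ?w S else 0)"
    using assms(2) by (intro sum.cong) (auto simp: sum.If_cases Int_def mult.commute)
  also have "\<dots> = (\<Sum>i\<in>I. \<Sum>S\<in>Pow V. if T i \<subseteq> S then ?w S else 0)"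
    by (rule sum.swap)
  also have "\<dots> = (\<Sum>i\<in>I. \<Sum>S | S \<subseteq> V \<and> T i \<subseteq> S. ?w S)"
    using assms(1)
    by (intro sum.cong[OF refl] sum.mono_neutral_cong_right) auto
  also have "\<dots> = (\<Sum>i\<in>I. p ^ k)"
    using assms by (intro sum.cong refl) (simp add: sum_superset_weights)
  finally show ?thesis by simp
qed

context geometric_graph
begin

text \<open>
  The linear bound, averaged over random induced subgraphs. A vertex survives with probability \<open>p\<close>, an
  edge with probability \<open>p\<^sup>2\<close>, and a crossing with probability \<open>p ^ 4\<close> because it involves four distinct
  vertices. Lowering \<open>p\<close> therefore weakens the crossings most.
\<close>

lemma crossing_bound_sampled:
  fixes p :: real
  assumes p: "0 \<le> p" "p \<le> 1"
  shows "p ^ 2 * real (card E) \<le> 3 * (p * real (card V)) + p ^ 4 * real (card (crossings E))"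
proof -
  let ?w = "\<lambda>S. p ^ card S * (1 - p) ^ card (V - S)"
  let ?E = "\<lambda>S. {e\<in>E. {fst e, snd e} \<subseteq> S}"
  let ?X = "\<lambda>S. {c\<in>crossings E. {fst (fst c), snd (fst c), fst (snd c), snd (snd c)} \<subseteq> S}"
  let ?V = "\<lambda>S. {v\<in>V. {v} \<subseteq> S}"
  have in_V: "{fst (fst c), snd (fst c), fst (snd c), snd (snd c)} \<subseteq> V" if "c \<in> crossings E" for c
    using that ends_in by (auto simp: crossings_def)
  have "(\<Sum>S\<in>Pow V. ?w S * real (card (?E S)))
      \<le> (\<Sum>S\<in>Pow V. ?w S * (3 * real (card (?V S)) + real (card (?X S))))"
  proof (intro sum_mono mult_left_mono)
    fix S assume "S \<in> Pow V"
    then have S: "S \<subseteq> V" by blast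
    interpret S: geometric_graph S "?E S"
      by (rule geometric_graph_induced) (use S in \<open>auto simp: mem_Times_iff\<close>)
    have "crossings (?E S) \<subseteq> ?X S" by (auto simp: crossings_def)
    then have "card (crossings (?E S)) \<le> card (?X S)"
      using finite_crossings by (intro card_mono) auto
    moreover have "?V S = S" using S by auto
    then have "card (?V S) = card S" by (rule arg_cong)
    ultimately have "card (?E S) \<le> 3 * card (?V S) + card (?X S)"
      using S.edge_bound_crossings by linarith
    then show "real (card (?E S)) \<le> 3 * real (card (?V S)) + real (card (?X S))" by linarith
    show "0 \<le> ?w S" using p by simp
  qed
  also have "\<dots> = 3 * (\<Sum>S\<in>Pow V. ?w S * real (card (?V S)))
      + (\<Sum>S\<in>Pow V. ?w S * real (card (?X S)))"
    by (simp add: algebra_simps sum.distrib sum_distrib_left)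
  also have "(\<Sum>S\<in>Pow V. ?w S * real (card (?V S))) = p ^ 1 * real (card V)"
    using finite_vertices by (intro sum_weighted_card) auto
  also have "(\<Sum>S\<in>Pow V. ?w S * real (card (?X S))) = p ^ 4 * real (card (crossings E))"
    using finite_vertices finite_crossings in_V
    by (intro sum_weighted_card) (auto intro: crossing_edges_disjoint)
  also have "(\<Sum>S\<in>Pow V. ?w S * real (card (?E S))) = p ^ 2 * real (card E)"
  proof (intro sum_weighted_card finite_vertices finite_edges)
    fix e assume e: "e \<in> E"
    show "{fst e, snd e} \<subseteq> V" using ends_in e by auto
    have "fst e \<noteq> snd e" using edge_rightwards[OF e] by auto
    then show "card {fst e, snd e} = 2" by simp
  qed
  finally show ?thesis by simp
qed

text \<open>
  The crossing lemma of Ajtai, Chvatal, Newborn, Szemeredi and Leighton for straight-line drawings.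
\<close>

theorem crossing_lemma:
  assumes "6 * card V \<le> card E"
  shows "card E ^ 3 \<le> 72 * card V ^ 2 * card (crossings E)"
proof (cases "card V = 0")
  case True
  then have "E = {}" using finite_vertices edges_subset by auto
  then show ?thesis by simp
next
  case False
  define v e c where "v = real (card V)" and "e = real (card E)" and "c = real (card (crossings E))"
  have v: "v > 0" and ve: "6 * v \<le> e" and "c \<ge> 0"
    using False assms by (auto simp: v_def e_def c_def)
  then have e: "e > 0" by linarith
  \<comment> \<open>With this probability the term with the vertices is half of the term with the edges.\<close>
  define p where "p = 6 * v / e"
  have p: "0 < p" "p \<le> 1" using v ve e by (auto simp: p_def)
  have "p ^ 2 * e \<le> 3 * (p * v) + p ^ 4 * c"
    using crossing_bound_sampled[of p] p by (simp add: v_def e_def c_def)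
  then have "(6 * v / e) ^ 2 * e * e ^ 4 \<le> (3 * (6 * v / e * v) + (6 * v / e) ^ 4 * c) * e ^ 4"
    unfolding p_def using e by (intro mult_right_mono) auto
  then have "36 * v^2 * e ^ 3 \<le> 18 * v^2 * e ^ 3 + 1296 * v ^ 4 * c"
    using e by (simp add: field_simps power2_eq_square power3_eq_cube power4_eq_xxxx)
  then have "(18 * v^2) * e ^ 3 \<le> (18 * v^2) * (72 * v ^ 2 * c)"
    by (simp add: algebra_simps power2_eq_square power4_eq_xxxx)
  moreover have "0 < 18 * v^2" using v by simp
  ultimately have "e ^ 3 \<le> 72 * v ^ 2 * c" by (rule mult_left_le_imp_le)
  then have "real (card E ^ 3) \<le> real (72 * card V ^ 2 * card (crossings E))"
    by (simp add: v_def e_def c_def)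
  then show ?thesis by linarith
qed

end

section \<open>Incidences of points with rich lines in the plane\<close>

text \<open>
  A line that is not vertical is encoded by its intercept and its slope.
\<close>

definition points_on :: "point set \<Rightarrow> real \<times> real \<Rightarrow> point set" where
  "points_on P l = {p \<in> P. snd p = fst l + snd l * fst p}"

definition consecutive_pairs :: "point set \<Rightarrow> (point \<times> point) set" where
  "consecutive_pairs A = {(p, q). p \<in> A \<and> q \<in> A \<and> fst p < fst q \<and>
     (\<forall>r \<in> A. \<not> (fst p < fst r \<and> fst r < fst q))}"

lemma consecutive_pairsD:
  assumes "e \<in> consecutive_pairs A"
  shows "fst e \<in> A" "snd e \<in> A" "fst (fst e) < fst (snd e)" "\<And>r. r \<in> A \<Longrightarrow> fst r \<notin> over e"
  using assms by (auto simp: consecutive_pairs_def over_def)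

lemma finite_consecutive_pairs: "finite A \<Longrightarrow> finite (consecutive_pairs A)"
  by (rule finite_subset[of _ "A \<times> A"]) (auto simp: consecutive_pairs_def)

lemma card_consecutive_pairs:
  assumes fin: "finite A" and inj: "inj_on fst A"
  shows "card A \<le> card (consecutive_pairs A) + 1"
proof (cases "A = {}")
  case False
  have "\<exists>m\<in>B. \<forall>a\<in>B. f m \<le> f a" if "finite B" "B \<noteq> {}" for B and f :: "point \<Rightarrow> real"
    using that by (metis arg_min_if_finite(1) arg_min_least)
  note least = this
  obtain m where m: "m \<in> A" "\<And>a. a \<in> A \<Longrightarrow> fst a \<le> fst m"
    using least[OF fin False, of "\<lambda>p. - fst p"] by auto
  have "A - {m} \<subseteq> fst ` consecutive_pairs A"
  proof
    fix p assume p: "p \<in> A - {m}"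
    then have "fst p \<noteq> fst m" using inj m(1) by (auto dest: inj_onD)
    then have "fst p < fst m" using m p by fastforce
    then have "{q \<in> A. fst p < fst q} \<noteq> {}" using m by blast
    moreover have "finite {q \<in> A. fst p < fst q}" using fin by simp
    ultimately obtain q where q: "q \<in> {q \<in> A. fst p < fst q}"
        and qmin: "\<forall>r \<in> {q \<in> A. fst p < fst q}. fst q \<le> fst r"
      using least[of "{q \<in> A. fst p < fst q}" fst] by blast
    have "\<not> (fst p < fst r \<and> fst r < fst q)" if "r \<in> A" for r
      using qmin[rule_format, of r] that by fastforce
    then have "(p, q) \<in> consecutive_pairs A"
      unfolding consecutive_pairs_def using p q by simp
    then show "p \<in> fst ` consecutive_pairs A" by force
  qed
  then have "card (A - {m}) \<le> card (fst ` consecutive_pairs A)"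
    using fin by (intro card_mono finite_imageI finite_consecutive_pairs)
  also have "\<dots> \<le> card (consecutive_pairs A)"
    using fin by (intro card_image_le finite_consecutive_pairs)
  finally show ?thesis using m fin by (simp add: card_Diff_singleton)
qed simp

text \<open>
  Consecutive pairs occupy disjoint intervals of abscissae.
\<close>

lemma consecutive_pairs_over_same:
  assumes "e \<in> consecutive_pairs A" "f \<in> consecutive_pairs A" "x \<in> over e" "x \<in> over f"
    and inj: "inj_on fst A"
  shows "e = f"
proof -
  note e = consecutive_pairsD[OF assms(1)] and f = consecutive_pairsD[OF assms(2)]
  have "fst (fst e) = fst (fst f)"
    using e(4)[OF f(1)] f(4)[OF e(1)] assms(3,4) by (auto simp: over_def)
  moreover have "fst (snd e) = fst (snd f)"
    using e(4)[OF f(2)] f(4)[OF e(2)] assms(3,4) by (auto simp: over_def)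
  ultimately have "fst e = fst f" "snd e = snd f"
    using e f inj by (auto dest: inj_onD)
  then show ?thesis by (simp add: prod_eq_iff)
qed

lemma height_consecutive_on_line:
  assumes "e \<in> consecutive_pairs (points_on P l)"
  shows "height e x = fst l + snd l * x"
proof -
  note e = consecutive_pairsD[OF assms]
  have 1: "snd (fst e) = fst l + snd l * fst (fst e)" "snd (snd e) = fst l + snd l * fst (snd e)"
    using e by (auto simp: points_on_def)
  have "snd (snd e) - snd (fst e) = snd l * (fst (snd e) - fst (fst e))"
    using 1 by (simp add: algebra_simps)
  then have "slope e = snd l" using e(3) by (simp add: slope_def)
  then show ?thesis using 1 by (simp add: height_def algebra_simps)
qed

lemma lines_meet_once:
  fixes l k :: "real \<times> real"
  assumes "fst l + snd l * x = fst k + snd k * x" "fst l + snd l * y = fst k + snd k * y" "x \<noteq> y"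
  shows "l = k"
proof -
  have "(snd l - snd k) * (x - y) = 0" using assms by (simp add: algebra_simps)
  then have "snd l = snd k" using assms(3) by simp
  then show ?thesis using assms by (simp add: prod_eq_iff)
qed

text \<open>
  Szekely's argument: join the points that are consecutive on a line of \<open>L\<close>. Two lines cross at most
  once, so this graph has at most \<open>(card L)\<^sup>2\<close> crossings, while it has at least half as many edges as
  there are incidences and at least \<open>M\<close> edges on every line. The crossing lemma thus bounds the number
  of edges without a bound on the number of lines.
\<close>

theorem szemeredi_trotter_rich_lines:
  assumes fin: "finite P" and inj: "inj_on fst P" and finL: "finite L" and M: "M \<ge> 1"
    and rich: "\<And>l. l \<in> L \<Longrightarrow> M < card (points_on P l)"
  shows "M\<^sup>2 * card {(p, l). l \<in> L \<and> p \<in> points_on P l} \<le> 12 * M\<^sup>2 * card P + 144 * (card P)\<^sup>2"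
proof -
  define edges where "edges l = consecutive_pairs (points_on P l)" for l
  define E where "E = (\<Union>l\<in>L. edges l)"
  have sub: "points_on P l \<subseteq> P" for l by (auto simp: points_on_def)
  have finO: "finite (points_on P l)" for l using fin sub finite_subset by blast
  have injO: "inj_on fst (points_on P l)" for l using inj sub inj_on_subset by blast
  have finE: "finite (edges l)" for l by (simp add: edges_def finO finite_consecutive_pairs)
  have h: "height e x = fst l + snd l * x" if "e \<in> edges l" for e l x
    using that by (simp add: edges_def height_consecutive_on_line)
  have line_unique: "l = k" if "e \<in> edges l" "e \<in> edges k" for e l k
  proof -
    have "fst (fst e) \<noteq> fst (snd e)"
      using consecutive_pairsD(3)[of e "points_on P l"] that by (simp add: edges_def)
    then show ?thesis using h that by (metis lines_meet_once)
  qed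
  interpret geometric_graph P E
  proof
    show "finite P" "inj_on fst P" by fact+
    show "E \<subseteq> P \<times> P"
      using sub by (auto simp: E_def edges_def consecutive_pairs_def)
    fix e assume "e \<in> E"
    then obtain l where l: "e \<in> edges l" by (auto simp: E_def)
    then show "fst (fst e) < fst (snd e)" by (simp add: edges_def consecutive_pairsD)
    show "snd v \<noteq> height e (fst v)" if v: "v \<in> P" "fst v \<in> over e" for v
    proof
      assume "snd v = height e (fst v)"
      then have "v \<in> points_on P l" using v h[OF l] by (simp add: points_on_def)
      then show False using v l consecutive_pairsD(4) unfolding edges_def by blast
    qed
  qed
  have "\<forall>e\<in>E. \<exists>l\<in>L. e \<in> edges l" by (auto simp: E_def)
  then obtain line where line: "\<And>e. e \<in> E \<Longrightarrow> line e \<in> L" "\<And>e. e \<in> E \<Longrightarrow> e \<in> edges (line e)"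
    by metis
  have same_edge: "e = f" if "e \<in> edges l" "f \<in> edges l" "x \<in> over e" "x \<in> over f" for e f l x
    using that consecutive_pairs_over_same injO unfolding edges_def by blast
  \<comment> \<open>A pair of lines determines the abscissa of its intersection, and a line together with an
      abscissa determines an edge.\<close>
  have "inj_on (\<lambda>c. (line (fst c), line (snd c))) (crossings E)"
  proof (rule inj_onI)
    fix c d assume c: "c \<in> crossings E" and d: "d \<in> crossings E"
      and eq: "(line (fst c), line (snd c)) = (line (fst d), line (snd d))"
    from c obtain x where cE: "fst c \<in> E" "snd c \<in> E" "fst c \<noteq> snd c"
      and x: "x \<in> over (fst c)" "x \<in> over (snd c)" "height (fst c) x = height (snd c) x"
      unfolding crossings_def case_prod_unfold by blast
    from d obtain y where dE: "fst d \<in> E" "snd d \<in> E"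
      and y: "y \<in> over (fst d)" "y \<in> over (snd d)" "height (fst d) y = height (snd d) y"
      unfolding crossings_def case_prod_unfold by blast
    note lc = line(2)[OF cE(1)] line(2)[OF cE(2)] and ld = line(2)[OF dE(1)] line(2)[OF dE(2)]
    have "line (fst c) \<noteq> line (snd c)" using same_edge lc x cE(3) by metis
    then have "x = y"
      using lines_meet_once[of "line (fst c)" x "line (snd c)" y] x(3) y(3) h[OF lc(1)] h[OF lc(2)]
        h[OF ld(1)] h[OF ld(2)] eq by auto
    then have "fst c = fst d" "snd c = snd d"
      using same_edge lc ld x y eq by (metis prod.inject)+
    then show "c = d" by (simp add: prod_eq_iff)
  qed
  then have "card (crossings E) \<le> card (L \<times> L)"
    by (rule card_inj_on_le) (use line(1) finL in \<open>auto simp: crossings_def\<close>)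
  then have X: "card (crossings E) \<le> (card L)\<^sup>2"
    by (simp add: card_cartesian_product power2_eq_square)
  have cE: "card E = (\<Sum>l\<in>L. card (edges l))"
    unfolding E_def using finL finE line_unique by (intro card_UN_disjoint) auto
  have e: "M \<le> card (edges l)" "card (points_on P l) \<le> 2 * card (edges l)" if "l \<in> L" for l
    using card_consecutive_pairs[OF finO injO, of l] rich[OF that] M unfolding edges_def by linarith+
  have LM: "M * card L \<le> card E"
    unfolding cE using sum_mono[of L "\<lambda>_. M" "\<lambda>l. card (edges l)"] e by (simp add: mult.commute)
  have pairs: "{(p, l). l \<in> L \<and> p \<in> points_on P l} = (\<lambda>(l, p). (p, l)) ` Sigma L (points_on P)"
    by auto
  then have "card {(p, l). l \<in> L \<and> p \<in> points_on P l} = card (Sigma L (points_on P))"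
    by (simp add: card_image inj_on_def)
  also have "\<dots> = (\<Sum>l\<in>L. card (points_on P l))" using finL finO by simp
  also have "\<dots> \<le> 2 * card E"
    unfolding cE sum_distrib_left using e by (intro sum_mono) auto
  finally have I: "card {(p, l). l \<in> L \<and> p \<in> points_on P l} \<le> 2 * card E" .
  show ?thesis
  proof (cases "card E < 6 * card P")
    case True
    then have "card {(p, l). l \<in> L \<and> p \<in> points_on P l} \<le> 12 * card P" using I by linarith
    then have "M\<^sup>2 * card {(p, l). l \<in> L \<and> p \<in> points_on P l} \<le> M\<^sup>2 * (12 * card P)"
      by (rule mult_le_mono2)
    also have "\<dots> = 12 * M\<^sup>2 * card P" by simp
    finally show ?thesis by (rule trans_le_add1)
  next
    case False
    then have "card E ^ 3 \<le> 72 * card P ^ 2 * card (crossings E)" by (intro crossing_lemma) simp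
    also have "\<dots> \<le> 72 * card P ^ 2 * (card L)\<^sup>2" using X by simp
    finally have "M\<^sup>2 * card E ^ 3 \<le> M\<^sup>2 * (72 * card P ^ 2 * (card L)\<^sup>2)" by (rule mult_le_mono2)
    also have "\<dots> = 72 * card P ^ 2 * (M * card L)\<^sup>2" by (simp add: power_mult_distrib)
    also have "\<dots> \<le> 72 * card P ^ 2 * (card E)\<^sup>2" using LM by (simp add: power_mono)
    \<comment> \<open>Eliminating the number of lines by means of the number of edges.\<close>
    finally have "(card E)\<^sup>2 * (M\<^sup>2 * card E) \<le> (card E)\<^sup>2 * (72 * card P ^ 2)"
      by (simp add: power2_eq_square power3_eq_cube mult_ac)
    then have *: "M\<^sup>2 * card E \<le> 72 * card P ^ 2" by (cases "card E = 0") auto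
    have "M\<^sup>2 * card {(p, l). l \<in> L \<and> p \<in> points_on P l} \<le> M\<^sup>2 * (2 * card E)"
      using I by (rule mult_le_mono2)
    also have "\<dots> = 2 * (M\<^sup>2 * card E)" by simp
    also have "\<dots> \<le> 144 * (card P)\<^sup>2" using * by linarith
    finally show ?thesis by (rule trans_le_add2)
  qed
qed

section \<open>Incidences with rich lines in higher dimensions\<close>

text \<open>
  On the moment curve \<open>(1, t, t\<^sup>2, \<dots>)\<close> the pairing with a nonzero vector is a nonzero polynomial in \<open>t\<close>,
  so that only finitely many \<open>t\<close> are excluded.
\<close>

lemma exists_generic_functional:
  fixes W :: "real vec set"
  assumes fin: "finite W" and W: "W \<subseteq> carrier_vec d" and nz: "0\<^sub>v d \<notin> W"
  shows "\<exists>g \<in> carrier_vec d. \<forall>w \<in> W. g \<bullet> w \<noteq> 0"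
proof -
  define poly_of where "poly_of w = (\<Sum>i<d. monom (w $ i) i)" for w :: "real vec"
  have coeff: "coeff (poly_of w) i = w $ i" if "i < d" for w i
    using that by (simp add: poly_of_def coeff_sum)
  have "poly_of w \<noteq> 0" if "w \<in> W" for w
  proof
    assume 0: "poly_of w = 0"
    have "w = 0\<^sub>v d"
      using W that coeff[of _ w] unfolding 0 by (intro eq_vecI) auto
    then show False using nz that by simp
  qed
  then have "finite (\<Union>w\<in>W. {t. poly (poly_of w) t = 0})"
    using fin by (auto intro: poly_roots_finite)
  then obtain t where t: "t \<notin> (\<Union>w\<in>W. {t. poly (poly_of w) t = 0})"
    using ex_new_if_finite[OF infinite_UNIV_char_0] by blast
  have "vec d (\<lambda>i. t ^ i) \<bullet> w = poly (poly_of w) t" if "w \<in> W" for w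
  proof -
    have "dim_vec w = d" using W that by auto
    then show ?thesis
      by (simp add: scalar_prod_def poly_of_def poly_sum poly_monom atLeast0LessThan mult.commute)
  qed
  then show ?thesis using t by (intro bexI[of _ "vec d (\<lambda>i. t ^ i)"]) auto
qed

definition fibre :: "real vec set \<Rightarrow> real vec \<Rightarrow> real vec \<Rightarrow> real vec set" where
  "fibre P v u = {w \<in> P. \<exists>t. w = v + t \<cdot>\<^sub>v u}"

text \<open>
  A linear map to the plane that gives the points of \<open>P\<close> distinct abscissae and creates no new collinear
  triples. Collinearity of the images of \<open>a\<close>, \<open>b\<close>, \<open>c\<close> means that the second functional vanishes on a
  vector formed from \<open>a\<close>, \<open>b\<close>, \<open>c\<close> and the first functional, so the two are chosen one after the other.
\<close>

lemma generic_planar_projection: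
  fixes P :: "real vec set"
  assumes fin: "finite P" and P: "P \<subseteq> carrier_vec d"
  shows "\<exists>g\<in>carrier_vec d. \<exists>h\<in>carrier_vec d. inj_on (\<lambda>v. g \<bullet> v) P \<and>
    (\<forall>a\<in>P. \<forall>b\<in>P. \<forall>c\<in>P. (g \<bullet> b - g \<bullet> a) * (h \<bullet> c - h \<bullet> a) = (g \<bullet> c - g \<bullet> a) * (h \<bullet> b - h \<bullet> a) \<longrightarrow>
       (g \<bullet> b - g \<bullet> a) \<cdot>\<^sub>v (c - a) = (g \<bullet> c - g \<bullet> a) \<cdot>\<^sub>v (b - a))"
proof -
  have carr: "b - a \<in> carrier_vec d" if "a \<in> P" "b \<in> P" for a b
    using that P by (meson minus_carrier_vec subsetD)
  let ?W = "(\<lambda>(a, b). b - a) ` (P \<times> P) - {0\<^sub>v d}"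
  have W: "finite ?W" "?W \<subseteq> carrier_vec d" "0\<^sub>v d \<notin> ?W"
    using fin carr by auto
  obtain g where g: "g \<in> carrier_vec d" and gW: "\<And>w. w \<in> ?W \<Longrightarrow> g \<bullet> w \<noteq> 0"
    using exists_generic_functional[OF W] by blast
  have diff: "f \<bullet> (b - a) = f \<bullet> b - f \<bullet> a" if "f \<in> carrier_vec d" "a \<in> P" "b \<in> P" for f a b
    using that P by (intro scalar_prod_minus_distrib) auto
  have "inj_on (\<lambda>v. g \<bullet> v) P"
  proof (rule inj_onI, rule ccontr)
    fix a b assume ab: "a \<in> P" "b \<in> P" "g \<bullet> a = g \<bullet> b" "a \<noteq> b"
    have "b - a \<noteq> 0\<^sub>v d"
    proof
      assume 0: "b - a = 0\<^sub>v d"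
      have "a = b"
      proof (rule eq_vecI)
        have dims: "dim_vec a = d" "dim_vec b = d" using ab P by auto
        then show "dim_vec a = dim_vec b" by simp
        fix i assume "i < dim_vec b"
        then show "a $ i = b $ i" using arg_cong[OF 0, of "\<lambda>v. v $ i"] dims by simp
      qed
      then show False using ab by simp
    qed
    then have "b - a \<in> ?W" using ab by force
    then show False using gW[of "b - a"] diff[OF g ab(1,2)] ab(3) by simp
  qed
  moreover
  define del where "del = (\<lambda>(a, b, c). (g \<bullet> b - g \<bullet> a) \<cdot>\<^sub>v (c - a) - (g \<bullet> c - g \<bullet> a) \<cdot>\<^sub>v (b - a))"
  let ?U = "del ` (P \<times> P \<times> P) - {0\<^sub>v d}"
  have U: "finite ?U" "?U \<subseteq> carrier_vec d" "0\<^sub>v d \<notin> ?U"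
    using fin carr by (auto simp: del_def)
  obtain h where h: "h \<in> carrier_vec d" and hU: "\<And>w. w \<in> ?U \<Longrightarrow> h \<bullet> w \<noteq> 0"
    using exists_generic_functional[OF U] by blast
  have "(g \<bullet> b - g \<bullet> a) \<cdot>\<^sub>v (c - a) = (g \<bullet> c - g \<bullet> a) \<cdot>\<^sub>v (b - a)"
    if abc: "a \<in> P" "b \<in> P" "c \<in> P"
      and eq: "(g \<bullet> b - g \<bullet> a) * (h \<bullet> c - h \<bullet> a) = (g \<bullet> c - g \<bullet> a) * (h \<bullet> b - h \<bullet> a)" for a b c
  proof -
    have carr: "c - a \<in> carrier_vec d" "b - a \<in> carrier_vec d" using abc carr by auto
    then have "h \<bullet> del (a, b, c)
        = (g \<bullet> b - g \<bullet> a) * (h \<bullet> (c - a)) - (g \<bullet> c - g \<bullet> a) * (h \<bullet> (b - a))"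
      using h by (simp add: del_def scalar_prod_minus_distrib[of _ d])
    also have "\<dots> = 0" using eq by (simp add: diff[OF h] abc)
    finally have "del (a, b, c) \<notin> ?U" using hU by blast
    then have 0: "del (a, b, c) = 0\<^sub>v d" using abc by blast
    show ?thesis
    proof (rule eq_vecI)
      have dims: "dim_vec a = d" "dim_vec b = d" "dim_vec c = d" using abc P by auto
      then show "dim_vec ((g \<bullet> b - g \<bullet> a) \<cdot>\<^sub>v (c - a)) = dim_vec ((g \<bullet> c - g \<bullet> a) \<cdot>\<^sub>v (b - a))"
        by simp
      fix i assume "i < dim_vec ((g \<bullet> c - g \<bullet> a) \<cdot>\<^sub>v (b - a))"
      then have i: "i < d" using dims by simp
      have "(g \<bullet> b - g \<bullet> a) * (c $ i - a $ i) - (g \<bullet> c - g \<bullet> a) * (b $ i - a $ i) = 0"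
        using arg_cong[OF 0, of "\<lambda>x. x $ i"] i dims by (simp add: del_def)
      then show "((g \<bullet> b - g \<bullet> a) \<cdot>\<^sub>v (c - a)) $ i = ((g \<bullet> c - g \<bullet> a) \<cdot>\<^sub>v (b - a)) $ i"
        using i dims by simp
    qed
  qed
  ultimately show ?thesis using g h by blast
qed

text \<open>
  The bound for rich lines in \<open>d\<close> dimensions. The lines are represented by the sets of points of \<open>P\<close> on them;
  a generic projection to the plane keeps these sets distinct and collinear and adds no points to them.
\<close>

theorem rich_incidences_bound:
  fixes P :: "real vec set"
  assumes fin: "finite P" and P: "P \<subseteq> carrier_vec d" and M: "M \<ge> 1"
  shows "M\<^sup>2 * card {(v, F). v \<in> P \<and> (\<exists>u\<in>carrier_vec d. F = fibre P v u \<and> M < card F)}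
    \<le> 12 * M\<^sup>2 * card P + 144 * (card P)\<^sup>2"
proof -
  obtain g h where g: "g \<in> carrier_vec d" and h: "h \<in> carrier_vec d" and inj: "inj_on (\<lambda>v. g \<bullet> v) P"
    and gen: "\<And>a b c. a \<in> P \<Longrightarrow> b \<in> P \<Longrightarrow> c \<in> P \<Longrightarrow>
      (g \<bullet> b - g \<bullet> a) * (h \<bullet> c - h \<bullet> a) = (g \<bullet> c - g \<bullet> a) * (h \<bullet> b - h \<bullet> a) \<Longrightarrow>
      (g \<bullet> b - g \<bullet> a) \<cdot>\<^sub>v (c - a) = (g \<bullet> c - g \<bullet> a) \<cdot>\<^sub>v (b - a)"
    using generic_planar_projection[OF fin P] by blast
  define pr where "pr v = (g \<bullet> v, h \<bullet> v)" for v
  have inj_pr: "inj_on pr P" using inj by (auto simp: pr_def inj_on_def)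
  have inj_fst: "inj_on fst (pr ` P)" using inj by (auto simp: pr_def inj_on_def)
  define I where "I = {(v, F). v \<in> P \<and> (\<exists>u\<in>carrier_vec d. F = fibre P v u \<and> M < card F)}"
  have line_ex: "\<exists>l. \<forall>w\<in>P. w \<in> F \<longleftrightarrow> pr w \<in> points_on (pr ` P) l"
    if v: "v \<in> P" and u: "u \<in> carrier_vec d" and F: "F = fibre P v u" and "M < card F" for v u F
  proof -
    have "\<not> F \<subseteq> {v}" using \<open>M < card F\<close> M card_mono[of "{v}" F] by auto
    then obtain w t where w: "w \<in> P" "w \<noteq> v" and wt: "w = v + t \<cdot>\<^sub>v u" using F by (auto simp: fibre_def)
    have vd: "v \<in> carrier_vec d" using v P by blast
    have lin: "f \<bullet> (v + s \<cdot>\<^sub>v u) = f \<bullet> v + s * (f \<bullet> u)" if "f \<in> carrier_vec d" for f s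
      using that vd u by (simp add: scalar_prod_add_distrib[of _ d])
    have "g \<bullet> w \<noteq> g \<bullet> v" using inj w v by (auto dest: inj_onD)
    then have nz: "t \<noteq> 0" "g \<bullet> u \<noteq> 0" unfolding wt using lin[OF g, of t] by auto
    \<comment> \<open>The slope of the projected line.\<close>
    define b where "b = (h \<bullet> u) / (g \<bullet> u)"
    have "z \<in> F \<longleftrightarrow> h \<bullet> z = (h \<bullet> v - b * (g \<bullet> v)) + b * (g \<bullet> z)" if z: "z \<in> P" for z
    proof
      assume "z \<in> F"
      then obtain s where "z = v + s \<cdot>\<^sub>v u" using F by (auto simp: fibre_def)
      then show "h \<bullet> z = (h \<bullet> v - b * (g \<bullet> v)) + b * (g \<bullet> z)"
        using nz by (simp add: lin[OF g] lin[OF h] b_def field_simps)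
    next
      assume eq: "h \<bullet> z = (h \<bullet> v - b * (g \<bullet> v)) + b * (g \<bullet> z)"
      have gw: "g \<bullet> w - g \<bullet> v = t * (g \<bullet> u)" "h \<bullet> w - h \<bullet> v = t * (h \<bullet> u)"
        by (simp_all add: wt lin[OF g] lin[OF h])
      have "h \<bullet> z - h \<bullet> v = b * (g \<bullet> z - g \<bullet> v)" using eq by (simp add: algebra_simps)
      then have "(g \<bullet> w - g \<bullet> v) * (h \<bullet> z - h \<bullet> v) = (g \<bullet> z - g \<bullet> v) * (h \<bullet> w - h \<bullet> v)"
        unfolding gw using nz by (simp add: b_def)
      then have eqv: "(g \<bullet> w - g \<bullet> v) \<cdot>\<^sub>v (z - v) = (g \<bullet> z - g \<bullet> v) \<cdot>\<^sub>v (w - v)"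
        using gen v w z by blast
      have "z = v + ((g \<bullet> z - g \<bullet> v) / (g \<bullet> u)) \<cdot>\<^sub>v u"
      proof (rule eq_vecI)
        have dims: "dim_vec v = d" "dim_vec u = d" "dim_vec z = d" using vd u z P by auto
        then show "dim_vec z = dim_vec (v + ((g \<bullet> z - g \<bullet> v) / (g \<bullet> u)) \<cdot>\<^sub>v u)" by simp
        fix i assume "i < dim_vec (v + ((g \<bullet> z - g \<bullet> v) / (g \<bullet> u)) \<cdot>\<^sub>v u)"
        then have i: "i < d" using dims by simp
        have "(t * (g \<bullet> u)) * (z $ i - v $ i) = (g \<bullet> z - g \<bullet> v) * (t * u $ i)"
          using arg_cong[OF eqv, of "\<lambda>x. x $ i"] i dims unfolding gw by (simp add: wt)
        then have "(g \<bullet> u) * (z $ i - v $ i) = (g \<bullet> z - g \<bullet> v) * u $ i"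
          using nz by simp
        then show "z $ i = (v + ((g \<bullet> z - g \<bullet> v) / (g \<bullet> u)) \<cdot>\<^sub>v u) $ i"
          using i dims nz by (simp add: field_simps)
      qed
      then show "z \<in> F" using z F by (auto simp: fibre_def)
    qed
    then have "\<forall>z\<in>P. z \<in> F \<longleftrightarrow> pr z \<in> points_on (pr ` P) (h \<bullet> v - b * (g \<bullet> v), b)"
      by (auto simp: points_on_def pr_def)
    then show ?thesis by blast
  qed
  have "\<forall>F\<in>snd ` I. \<exists>l. \<forall>w\<in>P. w \<in> F \<longleftrightarrow> pr w \<in> points_on (pr ` P) l"
    using line_ex by (fastforce simp: I_def)
  from bchoice[OF this] obtain line
    where "\<forall>F\<in>snd ` I. \<forall>w\<in>P. w \<in> F \<longleftrightarrow> pr w \<in> points_on (pr ` P) (line F)" ..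
  then have line: "w \<in> F \<longleftrightarrow> pr w \<in> points_on (pr ` P) (line F)" if "F \<in> snd ` I" "w \<in> P" for F w
    using that by blast
  have FP: "F \<subseteq> P" if "F \<in> snd ` I" for F using that by (auto simp: fibre_def I_def)
  have rich: "M < card (points_on (pr ` P) (line F))" if F: "F \<in> snd ` I" for F
  proof -
    have "points_on (pr ` P) (line F) = pr ` F"
      using line[OF F] FP[OF F] by (auto simp: points_on_def)
    moreover have "card (pr ` F) = card F" using inj_pr FP[OF F] by (meson card_image inj_on_subset)
    moreover have "M < card F" using F by (auto simp: I_def)
    ultimately show ?thesis by simp
  qed
  have finF: "finite (snd ` I)"
    by (rule finite_subset[of _ "Pow P"]) (use FP fin in auto)
  have ST: "M\<^sup>2 * card {(p, l). l \<in> line ` snd ` I \<and> p \<in> points_on (pr ` P) l}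
      \<le> 12 * M\<^sup>2 * card (pr ` P) + 144 * (card (pr ` P))\<^sup>2"
  proof (rule szemeredi_trotter_rich_lines)
    show "M < card (points_on (pr ` P) l)" if "l \<in> line ` snd ` I" for l
      using that rich by blast
  qed (use fin finF M inj_fst in auto)
  have "card I \<le> card {(p, l). l \<in> line ` snd ` I \<and> p \<in> points_on (pr ` P) l}"
  proof (rule card_inj_on_le)
    show "inj_on (\<lambda>(v, F). (pr v, line F)) I"
    proof (rule inj_onI, clarify)
      fix v F v' F'
      assume a: "(v, F) \<in> I" "(v', F') \<in> I" and eq: "pr v = pr v'" "line F = line F'"
      have F: "F \<in> snd ` I" "F' \<in> snd ` I" using a by force+
      have on_line: "G = {w \<in> P. pr w \<in> points_on (pr ` P) (line G)}" if "G \<in> snd ` I" for G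
        using line[OF that] FP[OF that] by blast
      have "F = {w \<in> P. pr w \<in> points_on (pr ` P) (line F)}" by (rule on_line[OF F(1)])
      also have "\<dots> = F'" unfolding eq(2) by (rule on_line[OF F(2), symmetric])
      finally have "F = F'" .
      moreover have "v = v'" using inj_pr a eq by (auto simp: I_def dest: inj_onD)
      ultimately show "v = v' \<and> F = F'" by blast
    qed
    have "v \<in> F" if "(v, F) \<in> I" for v F
    proof -
      from that obtain u where u: "u \<in> carrier_vec d" "F = fibre P v u" and v: "v \<in> P"
        unfolding I_def by blast
      have "v = v + 0 \<cdot>\<^sub>v u" using u v P by (intro eq_vecI) auto
      then show ?thesis using u v by (auto simp: fibre_def)
    qed
    then have mem: "(pr v, line F) \<in> {(p, l). l \<in> line ` snd ` I \<and> p \<in> points_on (pr ` P) l}"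
      if "(v, F) \<in> I" for v F
    proof -
      have F: "F \<in> snd ` I" using that by force
      moreover have "v \<in> P" using that unfolding I_def by blast
      ultimately have "pr v \<in> points_on (pr ` P) (line F)"
        using line \<open>(v, F) \<in> I\<close> \<open>\<And>v F. (v, F) \<in> I \<Longrightarrow> v \<in> F\<close> by blast
      then show ?thesis using F by blast
    qed
    show "(\<lambda>(v, F). (pr v, line F)) ` I
        \<subseteq> {(p, l). l \<in> line ` snd ` I \<and> p \<in> points_on (pr ` P) l}"
    proof (rule image_subsetI)
      fix c assume "c \<in> I"
      then show "(\<lambda>(v, F). (pr v, line F)) c
          \<in> {(p, l). l \<in> line ` snd ` I \<and> p \<in> points_on (pr ` P) l}"
        using mem[of "fst c" "snd c"] by (simp only: case_prod_beta prod.collapse)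
    qed
    show "finite {(p, l). l \<in> line ` snd ` I \<and> p \<in> points_on (pr ` P) l}"
      by (rule finite_subset[of _ "pr ` P \<times> line ` snd ` I"])
        (use fin finF in \<open>auto simp: points_on_def\<close>)
  qed
  then have "M\<^sup>2 * card I \<le> M\<^sup>2 * card {(p, l). l \<in> line ` snd ` I \<and> p \<in> points_on (pr ` P) l}"
    by (rule mult_le_mono2)
  also note ST
  finally show ?thesis unfolding card_image[OF inj_pr] I_def .
qed

section \<open>Determinants with a fixed first column\<close>

definition det_tuples :: "nat \<Rightarrow> real vec set \<Rightarrow> real \<Rightarrow> real vec list set" where
  "det_tuples d P c = {vs. length vs = d \<and> set vs \<subseteq> P \<and> det (mat_of_cols d vs) = c}"

lemma finite_det_tuples: "finite P \<Longrightarrow> finite (det_tuples d P c)"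
  by (rule finite_subset[OF _ finite_lists_length_eq[of P d]]) (auto simp: det_tuples_def)

text \<open>
  Laplace expansion; the cofactors of the first column do not depend on that column.
\<close>

lemma det_linear_first_column:
  fixes vs :: "real vec list"
  assumes "length vs = k"
  shows "\<exists>D. \<forall>u\<in>carrier_vec (Suc k). det (mat_of_cols (Suc k) (u # vs)) = (\<Sum>i<Suc k. u $ i * D i)"
proof (intro exI ballI)
  fix u :: "real vec" assume u: "u \<in> carrier_vec (Suc k)"
  let ?A = "\<lambda>u. mat_of_cols (Suc k) (u # vs)"
  have del: "mat_delete (?A u) i 0 = mat_delete (?A (0\<^sub>v (Suc k))) i 0" if "i < Suc k" for i
    using that by (intro eq_matI) (auto simp: mat_delete_def mat_of_cols_def)
  have "det (?A u) = (\<Sum>i<Suc k. ?A u $$ (i, 0) * cofactor (?A u) i 0)"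
    by (rule laplace_expansion_column) (use assms in auto)
  also have "\<dots> = (\<Sum>i<Suc k. u $ i * cofactor (?A (0\<^sub>v (Suc k))) i 0)"
    by (intro sum.cong refl) (simp add: cofactor_def del mat_of_cols_Cons_index_0)
  finally show "det (?A u) = (\<Sum>i<Suc k. u $ i * cofactor (?A (0\<^sub>v (Suc k))) i 0)" .
qed

text \<open>
  The projection of \<open>k + 1\<close> dimensions onto \<open>k\<close> along \<open>u\<close>: a multiple of \<open>u\<close> is subtracted to clear
  coordinate \<open>r\<close>, which is then dropped.
\<close>

definition project_along :: "nat \<Rightarrow> nat \<Rightarrow> real vec \<Rightarrow> real vec \<Rightarrow> real vec" where
  "project_along k r u v =
     vec k (\<lambda>i. let j = (if i < r then i else Suc i) in v $ j - u $ j * (v $ r / u $ r))"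

lemma project_along_carrier [simp]: "project_along k r u v \<in> carrier_vec k"
  by (simp add: project_along_def)

lemma project_along_eqD:
  assumes v: "v \<in> carrier_vec (Suc k)" and w: "w \<in> carrier_vec (Suc k)"
    and u: "u \<in> carrier_vec (Suc k)" and r: "r < Suc k" "u $ r \<noteq> 0"
    and eq: "project_along k r u w = project_along k r u v"
  shows "w = v + ((w $ r - v $ r) / u $ r) \<cdot>\<^sub>v u"
proof (rule eq_vecI)
  have dims: "dim_vec v = Suc k" "dim_vec u = Suc k" "dim_vec w = Suc k" using u v w by auto
  then show "dim_vec w = dim_vec (v + ((w $ r - v $ r) / u $ r) \<cdot>\<^sub>v u)" by simp
  fix j assume "j < dim_vec (v + ((w $ r - v $ r) / u $ r) \<cdot>\<^sub>v u)"
  then have j: "j < Suc k" using dims by simp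
  have *: "w $ j - u $ j * (w $ r / u $ r) = v $ j - u $ j * (v $ r / u $ r)"
  proof (cases "j = r")
    case True
    then show ?thesis using r by simp
  next
    case False
    define i where "i = (if j < r then j else j - 1)"
    have i: "i < k" "(if i < r then i else Suc i) = j" using False j r by (auto simp: i_def)
    have "project_along k r u w $ i = project_along k r u v $ i" using eq by simp
    then show ?thesis using i by (simp add: project_along_def)
  qed
  then show "w $ j = (v + ((w $ r - v $ r) / u $ r) \<cdot>\<^sub>v u) $ j"
    using j dims r by (simp add: field_simps)
qed

text \<open>
  Multiplying by a matrix that does not depend on \<open>vs\<close> turns the first column \<open>u\<close> into a unit vector,
  after which the first column can be expanded away.
\<close>

lemma det_project_along:
  assumes u: "u \<in> carrier_vec (Suc k)" and r: "r < Suc k" "u $ r \<noteq> 0"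
  shows "\<exists>a. \<forall>vs. length vs = k \<and> set vs \<subseteq> carrier_vec (Suc k) \<longrightarrow>
    det (mat_of_cols (Suc k) (u # vs)) = a * det (mat_of_cols k (map (project_along k r u) vs))"
proof (intro exI allI impI)
  let ?n = "Suc k"
  \<comment> \<open>The identity matrix with column \<open>r\<close> replaced by \<open>u\<close>, so that it maps the unit vector \<open>r\<close> to \<open>u\<close>.
      The columns of \<open>W\<close> are the preimages of \<open>u\<close> and of the vectors \<open>vs\<close>.\<close>
  let ?E = "mat ?n ?n (\<lambda>(i, j). if j = r then u $ i else if i = j then 1 else 0)"
  fix vs :: "real vec list" assume "length vs = k \<and> set vs \<subseteq> carrier_vec (Suc k)"
  then have len: "length vs = k" and vs: "\<And>j. j < k \<Longrightarrow> vs ! j \<in> carrier_vec ?n"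
    by (auto dest: nth_mem)
  define W where "W = mat ?n ?n (\<lambda>(i, j). if j = 0 then (if i = r then 1 else 0)
      else if i = r then vs ! (j - 1) $ r / u $ r
      else vs ! (j - 1) $ i - u $ i * (vs ! (j - 1) $ r / u $ r))"
  have W: "W \<in> carrier_mat ?n ?n" by (simp add: W_def)
  have "?E * W = mat_of_cols ?n (u # vs)"
  proof (rule eq_matI)
    fix i j assume "i < dim_row (mat_of_cols ?n (u # vs))" "j < dim_col (mat_of_cols ?n (u # vs))"
    then have i: "i < ?n" and j: "j < ?n" using len by auto
    have "(?E * W) $$ (i, j) = (\<Sum>l\<in>{0..<?n}. ?E $$ (i, l) * W $$ (l, j))"
      using i j W by (simp add: scalar_prod_def del: sum.op_ivl_Suc)
    also have "\<dots> = (\<Sum>l\<in>{0..<?n}. (if l = r then u $ i * W $$ (r, j) else 0) +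
        (if l = i then (if i = r then 0 else W $$ (i, j)) else 0))"
      using i by (intro sum.cong) auto
    also have "\<dots> = u $ i * W $$ (r, j) + (if i = r then 0 else W $$ (i, j))"
      using i r by (simp add: sum.distrib sum.delta del: sum.op_ivl_Suc)
    also have "\<dots> = mat_of_cols ?n (u # vs) $$ (i, j)"
      using i j r len by (cases j) (auto simp: W_def mat_of_cols_def)
    finally show "(?E * W) $$ (i, j) = mat_of_cols ?n (u # vs) $$ (i, j)" .
  qed (use W len in auto)
  then have "det (mat_of_cols ?n (u # vs)) = det (?E * W)" by simp
  also have "\<dots> = det ?E * det W" by (rule det_mult[OF _ W]) auto
  also have "det W = (\<Sum>i<?n. W $$ (i, 0) * cofactor W i 0)"
    by (rule laplace_expansion_column[OF W]) simp
  also have "\<dots> = (\<Sum>i<?n. if i = r then cofactor W r 0 else 0)"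
    by (intro sum.cong) (auto simp: W_def)
  also have "\<dots> = cofactor W r 0" using r by (simp add: sum.delta del: sum.lessThan_Suc)
  also have "\<dots> = (-1) ^ r * det (mat_of_cols k (map (project_along k r u) vs))"
  proof -
    have "mat_delete W r 0 = mat_of_cols k (map (project_along k r u) vs)"
      using r len by (intro eq_matI) (auto simp: mat_delete_def W_def mat_of_cols_def project_along_def Let_def)
    then show ?thesis by (simp add: cofactor_def)
  qed
  finally show "det (mat_of_cols ?n (u # vs))
      = (det ?E * (-1) ^ r) * det (mat_of_cols k (map (project_along k r u) vs))"
    by simp
qed

section \<open>Points with multiplicities\<close>

text \<open>
  The fibres are listed one after another, so that members of the same fibre stay close.
\<close>

lemma enumerate_by_fibres:
  fixes f :: "'a \<Rightarrow> 'b"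
  assumes fin: "finite Q" and M: "\<And>v. v \<in> Q \<Longrightarrow> card {w \<in> Q. f w = f v} \<le> M"
  shows "\<exists>g. bij_betw g Q {..<card Q} \<and> (\<forall>v\<in>Q. \<forall>w\<in>Q. f v = f w \<longrightarrow> g v < g w + M)"
proof -
  have union: "\<exists>g. bij_betw g {v\<in>Q. f v \<in> B} {..<card {v\<in>Q. f v \<in> B}} \<and>
      (\<forall>v\<in>Q. \<forall>w\<in>Q. f v \<in> B \<and> f v = f w \<longrightarrow> g v < g w + M)" if "finite B" for B
    using that
  proof (induction B)
    case empty
    then show ?case by (auto simp: bij_betw_def)
  next
    case (insert b B)
    let ?A = "{v\<in>Q. f v \<in> B}" and ?F = "{v\<in>Q. f v = b}"
    from insert.IH obtain g where g: "bij_betw g ?A {..<card ?A}"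
      and near: "\<And>v w. v \<in> Q \<Longrightarrow> w \<in> Q \<Longrightarrow> f v \<in> B \<Longrightarrow> f v = f w \<Longrightarrow> g v < g w + M" by blast
    have "finite ?F" using fin by simp
    then obtain e where e: "bij_betw e ?F {0..<card ?F}" using ex_bij_betw_finite_nat by blast
    define g' where "g' v = (if f v = b then card ?A + e v else g v)" for v
    have AF: "?A \<inter> ?F = {}" using insert.hyps by auto
    have un: "{v\<in>Q. f v \<in> insert b B} = ?A \<union> ?F" by auto
    have card: "card (?A \<union> ?F) = card ?A + card ?F" using fin AF by (intro card_Un_disjoint) auto
    have "bij_betw g' ?A {..<card ?A}"
      using g insert.hyps by (subst bij_betw_cong[of _ _ g]) (auto simp: g'_def)
    moreover have "bij_betw g' ?F {card ?A..<card ?A + card ?F}"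
    proof -
      have "bij_betw ((+) (card ?A)) {0..<card ?F} {card ?A..<card ?A + card ?F}"
        by (auto simp: bij_betw_def image_add_atLeastLessThan)
      from bij_betw_trans[OF e this] show ?thesis
        by (subst bij_betw_cong[of _ _ "(+) (card ?A) \<circ> e"]) (auto simp: g'_def)
    qed
    ultimately have "bij_betw g' (?A \<union> ?F) ({..<card ?A} \<union> {card ?A..<card ?A + card ?F})"
      by (rule bij_betw_combine) auto
    moreover have "{..<card ?A} \<union> {card ?A..<card ?A + card ?F} = {..<card ?A + card ?F}" by auto
    ultimately have bij: "bij_betw g' (?A \<union> ?F) {..<card (?A \<union> ?F)}" using card by simp
    have "g' v < g' w + M" if vw: "v \<in> Q" "w \<in> Q" "f v \<in> insert b B" "f v = f w" for v w
    proof (cases "f v = b")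
      case True
      then have "e v < card ?F" using e vw by (auto simp: bij_betw_def)
      also have "\<dots> \<le> M" using M[OF vw(1)] True by simp
      finally show ?thesis using True vw by (simp add: g'_def)
    next
      case False
      then show ?thesis using near[OF vw(1,2)] vw by (simp add: g'_def)
    qed
    then show ?case unfolding un using bij by blast
  qed
  have Q: "{v\<in>Q. f v \<in> f ` Q} = Q" by auto
  from union[OF finite_imageI[OF fin, of f]] show ?thesis unfolding Q by blast
qed

text \<open>
  Colour by the position modulo \<open>M\<close> in the list of fibres: less than \<open>M\<close> positions separate the members
  of a fibre, so they get distinct colours, and the colour classes are as equal as possible.
\<close>

lemma fibre_colouring:
  fixes f :: "'a \<Rightarrow> 'b"
  assumes fin: "finite Q" and fib: "\<And>v. v \<in> Q \<Longrightarrow> card {w \<in> Q. f w = f v} \<le> M" and M: "M \<ge> 1"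
  shows "\<exists>h::'a \<Rightarrow> nat. (\<forall>v. h v < M) \<and> (\<forall>v\<in>Q. \<forall>w\<in>Q. f v = f w \<and> h v = h w \<longrightarrow> v = w) \<and>
    (\<forall>c. card {v\<in>Q. h v = c} \<le> card Q div M + 1)"
proof -
  obtain g where g: "bij_betw g Q {..<card Q}"
    and near: "\<And>v w. v \<in> Q \<Longrightarrow> w \<in> Q \<Longrightarrow> f v = f w \<Longrightarrow> g v < g w + M"
    using enumerate_by_fibres[OF fin fib] by blast
  have below: "g v < card Q" if "v \<in> Q" for v using g that by (auto simp: bij_betw_def)
  have inj: "inj_on g Q" using g by (simp add: bij_betw_def)
  have same: "a = b" if "a mod M = b mod M" "a < b + M" "b < a + M" for a b :: nat
  proof -
    have "a div M = b div M"
    proof (rule ccontr)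
      assume ne: "a div M \<noteq> b div M"
      have "a = M * (a div M) + b mod M" "b = M * (b div M) + b mod M"
        using that(1) by (metis mult_div_mod_eq)+
      moreover have "M * (a div M) + M \<le> M * (b div M) \<or> M * (b div M) + M \<le> M * (a div M)"
        using ne by (metis add.commute linorder_neqE_nat mult_Suc_right mult_le_mono2 Suc_leI)
      ultimately show False using that by linarith
    qed
    then show ?thesis using that(1) by (metis mult_div_mod_eq)
  qed
  have "card {v\<in>Q. g v mod M = c} \<le> card Q div M + 1" for c
  proof -
    have "card {v\<in>Q. g v mod M = c} \<le> card {..card Q div M}"
    proof (rule card_inj_on_le)
      show "inj_on (\<lambda>v. g v div M) {v\<in>Q. g v mod M = c}"
      proof (rule inj_onI)
        fix v w assume "v \<in> {v\<in>Q. g v mod M = c}" "w \<in> {v\<in>Q. g v mod M = c}" "g v div M = g w div M"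
        then have "g v = g w" "v \<in> Q" "w \<in> Q" by (auto, metis mult_div_mod_eq)
        then show "v = w" using inj by (auto dest: inj_onD)
      qed
      show "(\<lambda>v. g v div M) ` {v\<in>Q. g v mod M = c} \<subseteq> {..card Q div M}"
      proof (rule image_subsetI)
        fix v assume "v \<in> {v\<in>Q. g v mod M = c}"
        then have "g v \<le> card Q" using below by (simp add: less_imp_le)
        then show "g v div M \<in> {..card Q div M}" by (simp add: div_le_mono)
      qed
    qed simp
    then show ?thesis by simp
  qed
  moreover have "v = w" if "v \<in> Q" "w \<in> Q" "f v = f w" "g v mod M = g w mod M" for v w
    using same[of "g v" "g w"] near that inj by (metis inj_onD)
  ultimately show ?thesis using M by (intro exI[of _ "\<lambda>v. g v mod M"]) auto
qed

text \<open>
  This turns a bound for tuples of distinct points into one for points with multiplicities. Tuples with a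
  prescribed list of colours are determined by their images under \<open>f\<close>, and these come from only \<open>k\<close>
  colour classes. There are \<open>M ^ k\<close> lists of colours.
\<close>

lemma card_tuples_via_colouring:
  fixes f :: "'a \<Rightarrow> 'b"
  assumes fin: "finite Q" and fib: "\<And>v. v \<in> Q \<Longrightarrow> card {w \<in> Q. f w = f v} \<le> M" and M: "M \<ge> 1"
    and B: "\<And>R. R \<subseteq> f ` Q \<Longrightarrow> card R \<le> k * (card Q div M + 1) \<Longrightarrow>
      card {ws. length ws = k \<and> set ws \<subseteq> R \<and> \<Phi> ws} \<le> B"
  shows "card {vs. length vs = k \<and> set vs \<subseteq> Q \<and> \<Phi> (map f vs)} \<le> M ^ k * B"
proof -
  obtain h :: "'a \<Rightarrow> nat" where h: "\<And>v. h v < M"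
    and inj: "\<And>v w. v \<in> Q \<Longrightarrow> w \<in> Q \<Longrightarrow> f v = f w \<Longrightarrow> h v = h w \<Longrightarrow> v = w"
    and size: "\<And>c. card {v\<in>Q. h v = c} \<le> card Q div M + 1"
    using fibre_colouring[of Q f M, OF fin fib M] by blast
  let ?S = "{vs. length vs = k \<and> set vs \<subseteq> Q \<and> \<Phi> (map f vs)}"
  let ?C = "{cs. set cs \<subseteq> {..<M} \<and> length cs = k}"
  have finS: "finite ?S"
    by (rule finite_subset[OF _ finite_lists_length_eq[OF fin, of k]]) auto
  have part: "card {vs\<in>?S. map h vs = cs} \<le> B" if cs: "cs \<in> ?C" for cs
  proof -
    let ?R = "f ` {v\<in>Q. h v \<in> set cs}"
    have "{v\<in>Q. h v \<in> set cs} = (\<Union>c\<in>set cs. {v\<in>Q. h v = c})" by auto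
    then have "card {v\<in>Q. h v \<in> set cs} \<le> (\<Sum>c\<in>set cs. card {v\<in>Q. h v = c})"
      using card_UN_le[of "set cs" "\<lambda>c. {v\<in>Q. h v = c}"] by simp
    also have "\<dots> \<le> (\<Sum>c\<in>set cs. card Q div M + 1)" by (intro sum_mono size)
    also have "\<dots> \<le> k * (card Q div M + 1)"
      using cs card_length[of cs] by (simp del: mult_Suc_right)
    finally have "card ?R \<le> k * (card Q div M + 1)"
      using card_image_le[of "{v\<in>Q. h v \<in> set cs}" f] fin by simp
    then have *: "card {ws. length ws = k \<and> set ws \<subseteq> ?R \<and> \<Phi> ws} \<le> B" by (intro B) auto
    have "card {vs\<in>?S. map h vs = cs} \<le> card {ws. length ws = k \<and> set ws \<subseteq> ?R \<and> \<Phi> ws}"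
    proof (rule card_inj_on_le)
      show "inj_on (map f) {vs\<in>?S. map h vs = cs}"
      proof (rule inj_onI)
        fix vs ws assume a: "vs \<in> {vs\<in>?S. map h vs = cs}" "ws \<in> {vs\<in>?S. map h vs = cs}"
          and eq: "map f vs = map f ws"
        show "vs = ws"
        proof (rule nth_equalityI)
          show "length vs = length ws" using a by simp
          fix i assume i: "i < length vs"
          then have i': "i < length ws" using a by simp
          have "f (vs ! i) = f (ws ! i)" using arg_cong[OF eq, of "\<lambda>l. l ! i"] i i' by simp
          moreover have "map h vs = map h ws" using a by simp
          then have "h (vs ! i) = h (ws ! i)" using i i' by (metis nth_map)
          moreover have "vs ! i \<in> Q" "ws ! i \<in> Q" using a i i' nth_mem by blast+
          ultimately show "vs ! i = ws ! i" using inj by blast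
        qed
      qed
      show "map f ` {vs\<in>?S. map h vs = cs} \<subseteq> {ws. length ws = k \<and> set ws \<subseteq> ?R \<and> \<Phi> ws}"
        by (auto simp: subset_iff)
      show "finite {ws. length ws = k \<and> set ws \<subseteq> ?R \<and> \<Phi> ws}"
        by (rule finite_subset[OF _ finite_lists_length_eq[of ?R k]]) (use fin in auto)
    qed
    with * show ?thesis by linarith
  qed
  have "?S = (\<Union>cs\<in>?C. {vs\<in>?S. map h vs = cs})" using h by auto
  then have "card ?S = card (\<Union>cs\<in>?C. {vs\<in>?S. map h vs = cs})" by (rule arg_cong)
  also have "\<dots> \<le> (\<Sum>cs\<in>?C. card {vs\<in>?S. map h vs = cs})"
    by (intro card_UN_le finite_lists_length_eq) simp
  also have "\<dots> \<le> (\<Sum>cs\<in>?C. B)" by (intro sum_mono part)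
  also have "\<dots> = M ^ k * B" by (simp add: card_lists_length_eq)
  finally show ?thesis .
qed

section \<open>Counting tuples with a given determinant\<close>

lemma finite_rich_incidences:
  "finite P \<Longrightarrow> finite {(v, F). v \<in> P \<and> (\<exists>u\<in>carrier_vec d. F = fibre P v u \<and> M < card F)}"
  by (rule finite_subset[of _ "P \<times> Pow P"]) (auto simp: fibre_def)

text \<open>
  Projecting along \<open>u\<close> turns determinants with first column \<open>u\<close> into multiples of determinants of one
  size less. At most \<open>M\<close> of the poor points have the same image.
\<close>

lemma card_poor_tuples:
  fixes P :: "real vec set"
  assumes fin: "finite P" and P: "P \<subseteq> carrier_vec (Suc k)" and M: "M \<ge> 1" and c: "c \<noteq> 0"
    and u: "u \<in> P"
    and B: "\<And>R c. finite R \<Longrightarrow> R \<subseteq> carrier_vec k \<Longrightarrow> card R \<le> k * (card P div M + 1) \<Longrightarrow> c \<noteq> 0 \<Longrightarrow>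
      card (det_tuples k R c) \<le> B"
  shows "card {vs. u # vs \<in> det_tuples (Suc k) P c \<and> (\<forall>v\<in>set vs. card (fibre P v u) \<le> M)} \<le> M ^ k * B"
proof (cases "{vs. u # vs \<in> det_tuples (Suc k) P c \<and> (\<forall>v\<in>set vs. card (fibre P v u) \<le> M)} = {}")
  case True
  then show ?thesis by (metis card.empty zero_le)
next
  case False
  then obtain ws where ws: "length ws = k" "set ws \<subseteq> P" "det (mat_of_cols (Suc k) (u # ws)) = c"
    by (auto simp: det_tuples_def)
  have uc: "u \<in> carrier_vec (Suc k)" using u P by blast
  have "\<exists>r<Suc k. u $ r \<noteq> 0"
  proof (rule ccontr)
    assume "\<not> ?thesis"
    then have "\<And>i. i < Suc k \<Longrightarrow> u $ i = 0" by blast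
    then have "det (mat_of_cols (Suc k) (u # ws)) = 0"
      using det_linear_first_column[OF ws(1)] uc by fastforce
    then show False using ws c by simp
  qed
  then obtain r where r: "r < Suc k" "u $ r \<noteq> 0" by blast
  let ?f = "project_along k r u"
  obtain a where a: "\<And>vs. length vs = k \<Longrightarrow> set vs \<subseteq> carrier_vec (Suc k) \<Longrightarrow>
      det (mat_of_cols (Suc k) (u # vs)) = a * det (mat_of_cols k (map ?f vs))"
    using det_project_along[OF uc r] by blast
  have a0: "a \<noteq> 0" using a[OF ws(1)] ws P c by auto
  define Q where "Q = {v\<in>P. card (fibre P v u) \<le> M}"
  have finQ: "finite Q" and QP: "Q \<subseteq> P" using fin by (auto simp: Q_def)
  have "{vs. u # vs \<in> det_tuples (Suc k) P c \<and> (\<forall>v\<in>set vs. card (fibre P v u) \<le> M)}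
      \<subseteq> {vs. length vs = k \<and> set vs \<subseteq> Q \<and> det (mat_of_cols k (map ?f vs)) = c / a}"
  proof
    fix vs assume vs: "vs \<in> {vs. u # vs \<in> det_tuples (Suc k) P c \<and> (\<forall>v\<in>set vs. card (fibre P v u) \<le> M)}"
    then have "length vs = k" "set vs \<subseteq> P" by (auto simp: det_tuples_def)
    moreover from this have "a * det (mat_of_cols k (map ?f vs)) = c"
      using a[of vs] vs P by (auto simp: det_tuples_def)
    ultimately show "vs \<in> {vs. length vs = k \<and> set vs \<subseteq> Q \<and> det (mat_of_cols k (map ?f vs)) = c / a}"
      using vs a0 by (auto simp: Q_def field_simps)
  qed
  then have "card {vs. u # vs \<in> det_tuples (Suc k) P c \<and> (\<forall>v\<in>set vs. card (fibre P v u) \<le> M)}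
      \<le> card {vs. length vs = k \<and> set vs \<subseteq> Q \<and> det (mat_of_cols k (map ?f vs)) = c / a}"
    by (intro card_mono finite_subset[OF _ finite_lists_length_eq[OF finQ, of k]]) auto
  also have "\<dots> \<le> M ^ k * B"
  proof (rule card_tuples_via_colouring[OF finQ _ M])
    fix v assume v: "v \<in> Q"
    have "{w \<in> Q. ?f w = ?f v} \<subseteq> fibre P v u"
    proof
      fix w assume w: "w \<in> {w \<in> Q. ?f w = ?f v}"
      then have "w = v + ((w $ r - v $ r) / u $ r) \<cdot>\<^sub>v u"
        using v QP P r uc by (intro project_along_eqD[of _ k]) auto
      then show "w \<in> fibre P v u" using w QP by (auto simp: fibre_def)
    qed
    then have "card {w \<in> Q. ?f w = ?f v} \<le> card (fibre P v u)"
      using fin by (intro card_mono) (auto simp: fibre_def)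
    then show "card {w \<in> Q. ?f w = ?f v} \<le> M" using v by (simp add: Q_def)
  next
    fix R assume R: "R \<subseteq> ?f ` Q" "card R \<le> k * (card Q div M + 1)"
    have "card Q div M \<le> card P div M" using QP fin by (intro div_le_mono card_mono)
    then have "k * (card Q div M + 1) \<le> k * (card P div M + 1)" by (intro mult_le_mono2) simp
    then have "card R \<le> k * (card P div M + 1)" using R(2) by linarith
    moreover have "finite R" "R \<subseteq> carrier_vec k" using R(1) finQ finite_surj by auto
    ultimately have "card (det_tuples k R (c / a)) \<le> B" using a0 c by (intro B) auto
    then show "card {ws. length ws = k \<and> set ws \<subseteq> R \<and> det (mat_of_cols k ws) = c / a} \<le> B"
      by (simp add: det_tuples_def)
  qed
  finally show ?thesis .
qed

text \<open>
  A line with two points of \<open>P\<close> determines its direction, and the value of the determinant fixes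
  the length of the direction vector.
\<close>

lemma same_fibre_same_determinant:
  assumes P: "P \<subseteq> carrier_vec (Suc k)" and v: "v \<in> P" and M: "1 < card (fibre P v u)"
    and eq: "fibre P v u = fibre P v u'" and u: "u \<in> carrier_vec (Suc k)" "u' \<in> carrier_vec (Suc k)"
    and len: "length vs = k"
    and det: "det (mat_of_cols (Suc k) (u # vs)) = c" "det (mat_of_cols (Suc k) (u' # vs)) = c" and c: "c \<noteq> 0"
  shows "u = u'"
proof -
  have "\<not> fibre P v u \<subseteq> {v}" using M card_mono[of "{v}" "fibre P v u"] by auto
  then obtain w where w: "w \<in> fibre P v u" "w \<noteq> v" by blast
  then obtain s t where s: "w = v + s \<cdot>\<^sub>v u" and t: "w = v + t \<cdot>\<^sub>v u'"
    using eq unfolding fibre_def by blast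
  have dims: "dim_vec v = Suc k" "dim_vec u = Suc k" "dim_vec u' = Suc k" using v P u by auto
  have st: "s * u $ i = t * u' $ i" if "i < Suc k" for i
    using arg_cong[OF s, of "\<lambda>x. x $ i"] arg_cong[OF t, of "\<lambda>x. x $ i"] that dims by simp
  have "s \<noteq> 0"
  proof
    assume "s = 0"
    then have "w = v" using s dims by (intro eq_vecI) auto
    then show False using w by simp
  qed
  obtain D where D: "\<And>x. x \<in> carrier_vec (Suc k) \<Longrightarrow>
      det (mat_of_cols (Suc k) (x # vs)) = (\<Sum>i<Suc k. x $ i * D i)"
    using det_linear_first_column[OF len] by blast
  have "s * c = (\<Sum>i<Suc k. s * u $ i * D i)"
    using D[OF u(1)] det(1) by (simp add: sum_distrib_left mult.assoc del: sum.lessThan_Suc)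
  also have "\<dots> = (\<Sum>i<Suc k. t * u' $ i * D i)" by (intro sum.cong refl) (simp add: st)
  also have "\<dots> = t * c"
    using D[OF u(2)] det(2) by (simp add: sum_distrib_left mult.assoc del: sum.lessThan_Suc)
  finally have "s = t" using c by simp
  then show ?thesis using st \<open>s \<noteq> 0\<close> dims by (intro eq_vecI) auto
qed

text \<open>
  If a later vector of the tuple lies on a rich line parallel to the first vector, then the first vector
  can be recovered from that line and the later vectors. The two vectors thus contribute one
  rich incidence instead of two free points.
\<close>

lemma card_rich_tuples:
  fixes P :: "real vec set"
  assumes fin: "finite P" and P: "P \<subseteq> carrier_vec (Suc k)" and M: "M \<ge> 1" and c: "c \<noteq> 0" and j: "j < k"
  shows "card {us \<in> det_tuples (Suc k) P c. M < card (fibre P (us ! Suc j) (hd us))}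
    \<le> card {(v, F). v \<in> P \<and> (\<exists>u\<in>carrier_vec (Suc k). F = fibre P v u \<and> M < card F)} * card P ^ (k - 1)"
proof -
  let ?I = "{(v, F). v \<in> P \<and> (\<exists>u\<in>carrier_vec (Suc k). F = fibre P v u \<and> M < card F)}"
  let ?R = "{us \<in> det_tuples (Suc k) P c. M < card (fibre P (us ! Suc j) (hd us))}"
  let ?L = "{ws. set ws \<subseteq> P \<and> length ws = k - 1}"
  define \<phi> where "\<phi> us = ((us ! Suc j, fibre P (us ! Suc j) (hd us)), take j (tl us) @ drop (Suc j) (tl us))"
    for us :: "real vec list"
  have shape: "\<exists>u vs. us = u # vs \<and> length vs = k \<and> u \<in> P \<and> set vs \<subseteq> P \<and>
      det (mat_of_cols (Suc k) (u # vs)) = c \<and> vs ! j \<in> P \<and> M < card (fibre P (vs ! j) u)"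
    if "us \<in> ?R" for us
    using that j by (cases us) (auto simp: det_tuples_def subset_iff)
  have "card ?R \<le> card (?I \<times> ?L)"
  proof (rule card_inj_on_le)
    show "inj_on \<phi> ?R"
    proof (rule inj_onI)
      fix us us' assume "us \<in> ?R" "us' \<in> ?R" and eq: "\<phi> us = \<phi> us'"
      then obtain u vs u' vs' where us: "us = u # vs" "length vs = k" "u \<in> P"
          "det (mat_of_cols (Suc k) (u # vs)) = c" "vs ! j \<in> P" "M < card (fibre P (vs ! j) u)"
        and us': "us' = u' # vs'" "length vs' = k" "u' \<in> P" "det (mat_of_cols (Suc k) (u' # vs')) = c"
        using shape by meson
      have "\<phi> (u # vs) = \<phi> (u' # vs')" using eq us(1) us'(1) by simp
      then have nth: "vs ! j = vs' ! j" and F': "fibre P (vs ! j) u = fibre P (vs' ! j) u'"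
        and rest: "take j vs @ drop (Suc j) vs = take j vs' @ drop (Suc j) vs'"
        unfolding \<phi>_def prod.inject list.sel nth_Cons_Suc by blast+
      have F: "fibre P (vs ! j) u = fibre P (vs ! j) u'" using F' unfolding nth .
      have "take j vs = take j vs'" "drop (Suc j) vs = drop (Suc j) vs'"
        using rest us us' by (auto simp: append_eq_append_conv)
      then have "vs = vs'" using nth us us' j by (metis id_take_nth_drop)
      moreover from this have "u = u'"
        using us us' F M P c by (intro same_fibre_same_determinant[of P k "vs ! j" u u' vs c]) auto
      ultimately show "us = us'" using us us' by simp
    qed
    show "\<phi> ` ?R \<subseteq> ?I \<times> ?L"
    proof (rule image_subsetI)
      fix us assume "us \<in> ?R"
      then obtain u vs where us: "us = u # vs" "length vs = k" "u \<in> P" "set vs \<subseteq> P"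
          "vs ! j \<in> P" "M < card (fibre P (vs ! j) u)"
        using shape by meson
      have "set (take j vs @ drop (Suc j) vs) \<subseteq> P"
        using us(4) set_take_subset[of j vs] set_drop_subset[of "Suc j" vs] by auto
      then show "\<phi> us \<in> ?I \<times> ?L" using us j P by (auto simp: \<phi>_def)
    qed
    show "finite (?I \<times> ?L)"
      using fin by (intro finite_cartesian_product finite_rich_incidences finite_lists_length_eq)
  qed
  also have "\<dots> = card ?I * card P ^ (k - 1)"
    using fin by (simp add: card_cartesian_product card_lists_length_eq)
  finally show ?thesis .
qed

text \<open>
  Either all vectors after the first one are poor, or one of the \<open>k\<close> positions after the first holds a
  vector on a rich line.
\<close>

lemma card_det_tuples_step:
  fixes P :: "real vec set"
  assumes fin: "finite P" and P: "P \<subseteq> carrier_vec (Suc k)" and M: "M \<ge> 1" and c: "c \<noteq> 0"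
    and B: "\<And>R c. finite R \<Longrightarrow> R \<subseteq> carrier_vec k \<Longrightarrow> card R \<le> k * (card P div M + 1) \<Longrightarrow> c \<noteq> 0 \<Longrightarrow>
      card (det_tuples k R c) \<le> B"
  shows "card (det_tuples (Suc k) P c) \<le> card P * (M ^ k * B) + k *
    (card {(v, F). v \<in> P \<and> (\<exists>u\<in>carrier_vec (Suc k). F = fibre P v u \<and> M < card F)} * card P ^ (k - 1))"
proof -
  let ?I = "{(v, F). v \<in> P \<and> (\<exists>u\<in>carrier_vec (Suc k). F = fibre P v u \<and> M < card F)}"
  let ?poor = "\<lambda>u. {vs. u # vs \<in> det_tuples (Suc k) P c \<and> (\<forall>v\<in>set vs. card (fibre P v u) \<le> M)}"
  let ?rich = "\<lambda>j. {us \<in> det_tuples (Suc k) P c. M < card (fibre P (us ! Suc j) (hd us))}"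
  have finT: "finite (det_tuples (Suc k) P c)" using fin by (rule finite_det_tuples)
  have finp: "finite (?poor u)" for u
    by (rule finite_subset[OF _ finite_imageI[OF finT, of tl]]) force
  have "det_tuples (Suc k) P c \<subseteq> (\<Union>u\<in>P. (#) u ` ?poor u) \<union> (\<Union>j<k. ?rich j)"
  proof
    fix us assume us: "us \<in> det_tuples (Suc k) P c"
    then obtain u vs where uv: "us = u # vs" "u \<in> P" "length vs = k"
      by (cases us) (auto simp: det_tuples_def)
    show "us \<in> (\<Union>u\<in>P. (#) u ` ?poor u) \<union> (\<Union>j<k. ?rich j)"
    proof (cases "\<forall>v\<in>set vs. card (fibre P v u) \<le> M")
      case True
      then show ?thesis using us uv by auto
    next
      case False
      then obtain j where "j < k" "M < card (fibre P (vs ! j) u)"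
        using uv by (metis in_set_conv_nth not_le)
      then show ?thesis using us uv by auto
    qed
  qed
  then have "card (det_tuples (Suc k) P c) \<le> card ((\<Union>u\<in>P. (#) u ` ?poor u) \<union> (\<Union>j<k. ?rich j))"
    using fin finT finp by (intro card_mono) auto
  also have "\<dots> \<le> card (\<Union>u\<in>P. (#) u ` ?poor u) + card (\<Union>j<k. ?rich j)" by (rule card_Un_le)
  also have "card (\<Union>u\<in>P. (#) u ` ?poor u) \<le> (\<Sum>u\<in>P. card ((#) u ` ?poor u))"
    using fin by (rule card_UN_le)
  also have "(\<Sum>u\<in>P. card ((#) u ` ?poor u)) \<le> (\<Sum>u\<in>P. M ^ k * B)"
  proof (rule sum_mono)
    fix u assume "u \<in> P"
    have "card ((#) u ` ?poor u) \<le> card (?poor u)" by (rule card_image_le[OF finp])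
    also have "\<dots> \<le> M ^ k * B" using card_poor_tuples[OF fin P M c \<open>u \<in> P\<close> B] .
    finally show "card ((#) u ` ?poor u) \<le> M ^ k * B" .
  qed
  also have "card (\<Union>j<k. ?rich j) \<le> (\<Sum>j<k. card (?rich j))" by (rule card_UN_le) simp
  also have "(\<Sum>j<k. card (?rich j)) \<le> (\<Sum>j<k. card ?I * card P ^ (k - 1))"
    using card_rich_tuples[OF fin P M c] by (intro sum_mono) simp
  finally show ?thesis by simp
qed

text \<open>
  In the induction step the poor tuples contribute, up to constants, \<open>n powr (k + 1 - \<delta>) * M powr \<delta>\<close>, where
  \<open>\<delta> = 2 / (k + 1)\<close> is the saving in dimension \<open>k\<close>, and the rich tuples contribute \<open>n ^ (k + 1) / M\<^sup>2 + n ^ k\<close>.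
  The two balance at \<open>M = n powr (1 / (k + 2))\<close>, which gives the saving \<open>2 / (k + 2)\<close> in dimension \<open>k + 1\<close>.
  All nonzero values \<open>c\<close> of the determinant are treated together because projecting rescales it.
\<close>

theorem det_tuples_bound:
  assumes "k \<ge> 1"
  shows "\<exists>C\<ge>0. \<forall>P c. finite P \<and> P \<subseteq> carrier_vec k \<and> c \<noteq> 0 \<longrightarrow>
    real (card (det_tuples k P c)) \<le> C * real (card P) powr (real k - 2 / (real k + 1))"
  using assms
proof (induction k rule: nat_induct_at_least)
  case base
  have "real (card (det_tuples 1 P c)) \<le> 1 * real (card P) powr (real 1 - 2 / (real 1 + 1))"
    if fin: "finite P" and P: "P \<subseteq> carrier_vec 1" for P and c :: real
  proof (cases "P = {}")
    case True
    then have "det_tuples 1 P c = {}" by (auto simp: det_tuples_def)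
    then show ?thesis by simp
  next
    case False
    have "det_tuples 1 P c \<subseteq> {[vec 1 (\<lambda>_. c)]}"
    proof
      fix vs assume vs: "vs \<in> det_tuples 1 P c"
      then obtain v where v: "vs = [v]" "v \<in> P"
        by (auto simp: det_tuples_def length_Suc_conv)
      then have "v $ 0 = c" using vs det_single[of "mat_of_cols 1 [v]"]
        by (simp add: det_tuples_def mat_of_cols_def)
      then have "v = vec 1 (\<lambda>_. c)" using v P by (intro eq_vecI) auto
      then show "vs \<in> {[vec 1 (\<lambda>_. c)]}" using v by simp
    qed
    then have "card (det_tuples 1 P c) \<le> 1" using card_mono[of "{[vec 1 (\<lambda>_. c)]}"] by fastforce
    moreover have "card P > 0" using False fin by (simp add: card_gt_0_iff)
    ultimately show ?thesis by simp
  qed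
  then show ?case by (intro exI[of _ 1]) auto
next
  case (Suc k)
  define e where "e = real k - 2 / (real k + 1)"
  define e' where "e' = real (Suc k) - 2 / (real (Suc k) + 1)"
  from Suc.IH obtain C where C: "C \<ge> 0" and IH: "\<And>P c. finite P \<Longrightarrow> P \<subseteq> carrier_vec k \<Longrightarrow> c \<noteq> 0 \<Longrightarrow>
      real (card (det_tuples k P c)) \<le> C * real (card P) powr e"
    unfolding e_def by blast
  have k: "real k \<ge> 1" using Suc.hyps by simp
  have "2 / (real k + 1) \<le> 1" using k by simp
  then have e: "e \<ge> 0" using k unfolding e_def by linarith
  have "real (card (det_tuples (Suc k) P c))
      \<le> (2 ^ k * C * (2 * real k) powr e + 156 * real k) * real (card P) powr e'"
    if fin: "finite P" and P: "P \<subseteq> carrier_vec (Suc k)" and c: "c \<noteq> 0" for P and c :: real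
  proof (cases "P = {}")
    case True
    then have "det_tuples (Suc k) P c = {}" by (auto simp: det_tuples_def)
    then show ?thesis using C k by simp
  next
    case False
    define n where "n = real (card P)"
    have n: "n \<ge> 1" using False fin by (simp add: n_def Suc_leI card_gt_0_iff)
    define x where "x = n powr (1 / (real k + 2))"
    have x: "x \<ge> 1" "x \<le> n"
      using n powr_mono[of 0 "1 / (real k + 2)" n] powr_mono[of "1 / (real k + 2)" 1 n]
      by (auto simp: x_def)
    have nx: "n / x = n powr (1 - 1 / (real k + 2))" using n by (simp add: x_def powr_diff)
    have xpow: "x ^ m = n powr (real m * (1 / (real k + 2)))" for m
      using n x by (simp add: x_def powr_powr mult.commute flip: powr_realpow)
    \<comment> \<open>The balanced threshold, rounded up; it is at most twice \<open>x\<close> and at most \<open>n\<close>.\<close>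
    define M where "M = nat \<lceil>x\<rceil>"
    have M1: "M \<ge> 1" and xM: "x \<le> real M" using x by (auto simp: M_def, linarith+)
    have Mx: "real M \<le> 2 * x" using x by (auto simp: M_def, linarith)
    have "M \<le> card P" using x(2) by (simp add: M_def n_def)
    then have nM: "1 \<le> n / real M" using M1 by (simp add: n_def)
    \<comment> \<open>Colour classes have size about \<open>n / M\<close>; replacing \<open>M\<close> by the smaller \<open>x\<close> only increases the bound.\<close>
    define B where "B = nat \<lfloor>C * (2 * real k * (n / x)) powr e\<rfloor>"
    have BC: "real B \<le> C * (2 * real k * (n / x)) powr e"
      using C by (simp add: B_def)
    have Bb: "card (det_tuples k R b) \<le> B"
      if R: "finite R" "R \<subseteq> carrier_vec k" "card R \<le> k * (card P div M + 1)" "b \<noteq> 0" for R b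
    proof -
      have "real (card R) \<le> real (k * (card P div M + 1))" using R(3) by (simp only: of_nat_le_iff)
      also have "\<dots> = real k * (real (card P div M) + 1)" by (simp add: algebra_simps)
      also have "\<dots> \<le> real k * (n / real M + n / real M)"
        using nM of_nat_div_le_of_nat[of "card P" M] unfolding n_def
        by (intro mult_left_mono add_mono) auto
      also have "\<dots> = 2 * real k * (n / real M)" by simp
      also have "\<dots> \<le> 2 * real k * (n / x)"
        using xM x n by (intro mult_left_mono divide_left_mono) auto
      finally have "real (card R) powr e \<le> (2 * real k * (n / x)) powr e"
        using e by (intro powr_mono2) auto
      then have "real (card (det_tuples k R b)) \<le> C * (2 * real k * (n / x)) powr e"
        using IH[OF R(1,2,4)] C by (meson mult_left_mono order_trans)
      then show ?thesis unfolding B_def by (simp add: le_nat_floor)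
    qed
    let ?I = "{(v, F). v \<in> P \<and> (\<exists>u\<in>carrier_vec (Suc k). F = fibre P v u \<and> M < card F)}"
    have "card (det_tuples (Suc k) P c) \<le> card P * (M ^ k * B) + k * (card ?I * card P ^ (k - 1))"
      by (rule card_det_tuples_step[OF fin P M1 c Bb])
    then have "real (card (det_tuples (Suc k) P c)) \<le> real (card P * (M ^ k * B) + k * (card ?I * card P ^ (k - 1)))"
      by (simp only: of_nat_le_iff)
    also have "\<dots> = n * (real M ^ k * real B) + real k * (real (card ?I) * n ^ (k - 1))"
      by (simp add: n_def)
    also have "n * (real M ^ k * real B) \<le> 2 ^ k * C * (2 * real k) powr e * n powr e'"
    proof -
      have "n * (real M ^ k * real B) \<le> n * ((2 * x) ^ k * (C * (2 * real k * (n / x)) powr e))"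
        using n Mx x BC C by (intro mult_left_mono mult_mono power_mono) auto
      also have "\<dots> = 2 ^ k * C * (2 * real k) powr e * (n * x ^ k * (n / x) powr e)"
      proof -
        have "(2 * real k * (n / x)) powr e = (2 * real k) powr e * (n / x) powr e"
          by (rule powr_mult)
        then show ?thesis by (simp only: power_mult_distrib mult_ac)
      qed
      also have "n * x ^ k * (n / x) powr e = n powr e'"
      proof -
        have "n * x ^ k * (n / x) powr e
            = n powr (1 + real k * (1 / (real k + 2)) + (1 - 1 / (real k + 2)) * e)"
          using n unfolding xpow nx powr_powr powr_add by simp
        also have "1 + real k * (1 / (real k + 2)) + (1 - 1 / (real k + 2)) * e = e'"
        proof -
          have "1 - 1 / (real k + 2) = (real k + 1) / (real k + 2)" using k by (simp add: field_simps)
          moreover have "e = (real k * (real k + 1) - 2) / (real k + 1)"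
            using k by (simp add: e_def field_simps)
          ultimately have fe: "(1 - 1 / (real k + 2)) * e = (real k * (real k + 1) - 2) / (real k + 2)"
            using k by simp
          define y where "y = real k + 2"
          have y: "y \<noteq> 0" using k by (simp add: y_def)
          have "1 + real k * (1 / y) + (real k * (real k + 1) - 2) / y
              = (y + real k + (real k * (real k + 1) - 2)) / y"
            using y by (simp add: add_divide_distrib diff_divide_distrib)
          also have "y + real k + (real k * (real k + 1) - 2) = (real k + 1) * y - 2"
            by (simp add: y_def algebra_simps)
          also have "((real k + 1) * y - 2) / y = real k + 1 - 2 / y"
            using y by (simp add: diff_divide_distrib)
          also have "\<dots> = e'" by (simp add: e'_def y_def add.commute)
          finally show ?thesis unfolding fe y_def .
        qed
        finally show ?thesis .
      qed
      finally show ?thesis .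
    qed
    also have "real k * (real (card ?I) * n ^ (k - 1)) \<le> 156 * real k * n powr e'"
    proof -
      have "M\<^sup>2 * card ?I \<le> 12 * M\<^sup>2 * card P + 144 * (card P)\<^sup>2"
        by (rule rich_incidences_bound[OF fin P M1])
      then have "real (M\<^sup>2 * card ?I) \<le> real (12 * M\<^sup>2 * card P + 144 * (card P)\<^sup>2)"
        by (simp only: of_nat_le_iff)
      then have "(real M)\<^sup>2 * real (card ?I) \<le> 12 * (real M)\<^sup>2 * n + 144 * n\<^sup>2" by (simp add: n_def)
      then have "real (card ?I) \<le> 12 * n + 144 * n\<^sup>2 / (real M)\<^sup>2"
        using M1 by (simp add: field_simps)
      also have "144 * n\<^sup>2 / (real M)\<^sup>2 \<le> 144 * n\<^sup>2 / x\<^sup>2"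
        using xM x by (intro divide_left_mono power_mono) auto
      finally have "real (card ?I) * n ^ (k - 1) \<le> (12 * n + 144 * n\<^sup>2 / x\<^sup>2) * n ^ (k - 1)"
        using n by (intro mult_right_mono) auto
      also have "\<dots> = 12 * (n * n ^ (k - 1)) + 144 * (n * (n * n ^ (k - 1)) / x\<^sup>2)"
        by (simp add: power2_eq_square algebra_simps)
      also have "n * n ^ (k - 1) = n powr real k"
        using n Suc.hyps by (simp add: powr_realpow flip: power_Suc)
      also have "n * n powr real k / x\<^sup>2 = n powr e'"
      proof -
        have "n * n powr real k / x\<^sup>2 = n powr (1 + real k - 2 * (1 / (real k + 2)))"
          using n unfolding xpow powr_add powr_diff by simp
        also have "1 + real k - 2 * (1 / (real k + 2)) = e'" by (simp add: e'_def add.commute add.left_commute)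
        finally show ?thesis .
      qed
      also have "n powr real k \<le> n powr e'"
        using n by (intro powr_mono) (auto simp: e'_def field_simps)
      finally have "real (card ?I) * n ^ (k - 1) \<le> 156 * n powr e'" by simp
      then have "real k * (real (card ?I) * n ^ (k - 1)) \<le> real k * (156 * n powr e')"
        using k by (intro mult_left_mono) auto
      then show ?thesis by simp
    qed
    finally show ?thesis by (simp add: n_def algebra_simps)
  qed
  then show ?case unfolding e'_def using C
    by (intro exI[of _ "2 ^ k * C * (2 * real k) powr e + 156 * real k"]) auto
qed

section \<open>Unit minors\<close>

lemma abs_det_mat_of_cols_permute:
  fixes xs ys :: "real vec list"
  assumes len: "length xs = d" and eq: "mset xs = mset ys"
  shows "\<bar>det (mat_of_cols d xs)\<bar> = \<bar>det (mat_of_cols d ys)\<bar>"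
proof -
  have len': "length ys = d" using len eq mset_eq_length by metis
  obtain p where p: "p permutes {..<length ys}" and xs: "permute_list p ys = xs"
    using mset_eq_permutation[OF eq] by blast
  have rows_carrier: "mat_of_rows d zs \<in> carrier_mat d d" if "length zs = d" for zs :: "real vec list"
    using mat_of_rows_carrier(1)[of d zs] that by simp
  have pd: "p permutes {0..<d}" using p len' by (simp add: atLeast0LessThan)
  have "det (mat_of_cols d xs) = det (mat_of_rows d xs)"
    using det_transpose[OF rows_carrier[OF len]] by (simp add: transpose_mat_of_rows)
  also have "mat_of_rows d xs = mat d d (\<lambda>(i, j). mat_of_rows d ys $$ (p i, j))"
  proof (rule eq_matI)
    fix i j assume "i < dim_row (mat d d (\<lambda>(i, j). mat_of_rows d ys $$ (p i, j)))"
      "j < dim_col (mat d d (\<lambda>(i, j). mat_of_rows d ys $$ (p i, j)))"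
    then have ij: "i < d" "j < d" by auto
    have "p i < d" using pd ij permutes_in_image[OF pd, of i] by simp
    moreover have "xs ! i = ys ! p i" using ij len' xs p by (auto simp: permute_list_nth)
    ultimately show "mat_of_rows d xs $$ (i, j) = mat d d (\<lambda>(i, j). mat_of_rows d ys $$ (p i, j)) $$ (i, j)"
      using ij len len' by (simp add: mat_of_rows_index)
  qed (use len in auto)
  also have "det \<dots> = signof p * det (mat_of_rows d ys)"
    by (rule det_permute_rows[OF rows_carrier[OF len'] pd])
  also have "det (mat_of_rows d ys) = det (mat_of_cols d ys)"
    using det_transpose[OF rows_carrier[OF len']] by (simp add: transpose_mat_of_rows)
  finally show ?thesis by (simp add: abs_mult sign_def)
qed

lemma pick_image:
  assumes "finite J"
  shows "pick J ` {..<card J} = J"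
proof
  show "pick J ` {..<card J} \<subseteq> J" using pick_in_set_le by blast
  show "J \<subseteq> pick J ` {..<card J}"
  proof
    fix j assume j: "j \<in> J"
    then have "card {a\<in>J. a < j} < card J" using assms by (intro psubset_card_mono) auto
    then show "j \<in> pick J ` {..<card J}" using pick_card_in_set[OF j] by force
  qed
qed

lemma submatrix_eq_mat_of_cols:
  fixes A :: "real mat"
  assumes A: "A \<in> carrier_mat d n" and J: "J \<subseteq> {..<n}" "card J = d"
  shows "submatrix A UNIV J = mat_of_cols d (map (\<lambda>j. col A (pick J j)) [0..<d])"
proof (rule eq_matI)
  have cardJ: "card {j. j < dim_col A \<and> j \<in> J} = d"
  proof -
    have "{j. j < dim_col A \<and> j \<in> J} = J" using A J by auto
    then show ?thesis using J by simp
  qed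
  then show "dim_row (submatrix A UNIV J) = dim_row (mat_of_cols d (map (\<lambda>j. col A (pick J j)) [0..<d]))"
    "dim_col (submatrix A UNIV J) = dim_col (mat_of_cols d (map (\<lambda>j. col A (pick J j)) [0..<d]))"
    using A by (simp_all add: dim_submatrix)
  fix i j assume "i < dim_row (mat_of_cols d (map (\<lambda>j. col A (pick J j)) [0..<d]))"
    "j < dim_col (mat_of_cols d (map (\<lambda>j. col A (pick J j)) [0..<d]))"
  then have ij: "i < d" "j < d" by auto
  have "pick J j < n" using pick_in_set_le[of j J] ij J by auto
  then show "submatrix A UNIV J $$ (i, j) = mat_of_cols d (map (\<lambda>j. col A (pick J j)) [0..<d]) $$ (i, j)"
    using ij A cardJ by (subst submatrix_index) (auto simp: mat_of_cols_index pick_UNIV)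
qed

lemma set_picked_columns:
  assumes "finite J" "card J = d"
  shows "set (map (\<lambda>j. f (pick J j)) [0..<d]) = f ` J"
proof -
  have "set (map (\<lambda>j. f (pick J j)) [0..<d]) = f ` pick J ` {..<d}"
    by (simp add: image_image atLeast0LessThan)
  then show ?thesis using pick_image[OF assms(1)] assms(2) by simp
qed

text \<open>
  The columns are distinct, so the list of the chosen columns determines the set of their indices.
\<close>

lemma card_unit_minors_le_det_tuples:
  assumes A: "A \<in> carrier_mat d n" and dist: "distinct (cols A)"
  shows "card (unit_minors A) \<le> card (det_tuples d (set (cols A)) 1)"
proof (rule card_inj_on_le)
  let ?f = "\<lambda>J. map (\<lambda>j. col A (pick J j)) [0..<d]"
  have unit: "J \<subseteq> {..<n} \<and> card J = d \<and> det (mat_of_cols d (?f J)) = 1" if "J \<in> unit_minors A" for J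
    using that A submatrix_eq_mat_of_cols[OF A, of J] by (auto simp: unit_minors_def)
  have set_f: "set (?f J) = col A ` J" if "J \<in> unit_minors A" for J
    using unit[OF that] finite_subset[of J "{..<n}"] by (intro set_picked_columns) auto
  have inj: "inj_on (col A) {..<n}"
    using dist A by (simp add: cols_def distinct_map atLeast0LessThan)
  show "inj_on ?f (unit_minors A)"
  proof (rule inj_onI)
    fix J K assume J: "J \<in> unit_minors A" and K: "K \<in> unit_minors A" and "?f J = ?f K"
    then have "col A ` J = col A ` K" using set_f by metis
    then show "J = K" using inj unit[OF J] unit[OF K] by (metis inj_on_image_eq_iff)
  qed
  show "?f ` unit_minors A \<subseteq> det_tuples d (set (cols A)) 1"
  proof (rule image_subsetI)
    fix J assume J: "J \<in> unit_minors A"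
    have "col A ` J \<subseteq> set (cols A)" using unit[OF J] A by (auto simp: cols_def)
    then show "?f J \<in> det_tuples d (set (cols A)) 1"
      using unit[OF J] set_f[OF J] unfolding det_tuples_def by simp
  qed
  show "finite (det_tuples d (set (cols A)) 1)" by (intro finite_det_tuples) simp
qed

lemma max_unit_minors_bound:
  assumes "d > 0"
  shows "\<exists>C\<ge>0. \<forall>n. real (max_unit_minors d n) \<le> C * real n powr (real d - 2 / (real d + 1))"
proof -
  obtain C where C: "C \<ge> 0" and bound: "\<And>P c. finite P \<Longrightarrow> P \<subseteq> carrier_vec d \<Longrightarrow> c \<noteq> 0 \<Longrightarrow>
      real (card (det_tuples d P c)) \<le> C * real (card P) powr (real d - 2 / (real d + 1))"
    using det_tuples_bound[of d] assms by auto
  have "real (max_unit_minors d n) \<le> C * real n powr (real d - 2 / (real d + 1))" for n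
  proof -
    have "max_unit_minors d n \<in> {card (unit_minors A) | A. A \<in> carrier_mat d n \<and> distinct (cols A)}"
      unfolding max_unit_minors_def
      by (rule Max_in[OF max_unit_minors_finite max_unit_minors_nonempty[OF assms]])
    then obtain A where A: "A \<in> carrier_mat d n" "distinct (cols A)"
      and max: "max_unit_minors d n = card (unit_minors A)" by blast
    have "real (max_unit_minors d n) \<le> real (card (det_tuples d (set (cols A)) 1))"
      unfolding max using card_unit_minors_le_det_tuples[OF A] by simp
    also have "\<dots> \<le> C * real (card (set (cols A))) powr (real d - 2 / (real d + 1))"
      using A cols_dim[of A] by (intro bound) auto
    also have "card (set (cols A)) = n" using A by (simp add: distinct_card)
    finally show ?thesis .
  qed
  then show ?thesis using C by blast
qed

lemma unit_minors_of_columns: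
  fixes vs :: "real vec list"
  assumes vs: "set vs \<subseteq> carrier_vec d" "distinct vs" "length vs = n"
  shows "finite (unit_minors (mat_of_cols d vs))"
    and "card (unit_minors (mat_of_cols d vs)) \<le> max_unit_minors d n"
    and "J \<subseteq> {..<n} \<Longrightarrow> card J = d \<Longrightarrow> det (mat_of_cols d (map (\<lambda>j. vs ! pick J j) [0..<d])) = 1
      \<Longrightarrow> J \<in> unit_minors (mat_of_cols d vs)"
proof -
  have A: "mat_of_cols d vs \<in> carrier_mat d n" using vs by auto
  have cols: "cols (mat_of_cols d vs) = vs" using vs by (simp add: cols_mat_of_cols)
  show "finite (unit_minors (mat_of_cols d vs))"
    by (rule finite_subset[of _ "Pow {..<n}"]) (use A vs in \<open>auto simp: unit_minors_def\<close>)
  show "card (unit_minors (mat_of_cols d vs)) \<le> max_unit_minors d n"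
    unfolding max_unit_minors_def
    by (rule Max_ge[OF max_unit_minors_finite]) (use A cols vs in auto)
  assume J: "J \<subseteq> {..<n}" "card J = d" "det (mat_of_cols d (map (\<lambda>j. vs ! pick J j) [0..<d])) = 1"
  have picked: "map (\<lambda>j. col (mat_of_cols d vs) (pick J j)) [0..<d] = map (\<lambda>j. vs ! pick J j) [0..<d]"
  proof (rule map_cong[OF refl])
    fix j assume "j \<in> set [0..<d]"
    then have "pick J j < length vs" using pick_in_set_le[of j J] J vs by auto
    then show "col (mat_of_cols d vs) (pick J j) = vs ! pick J j"
      using vs nth_mem by (intro col_mat_of_cols) blast+
  qed
  have "det (submatrix (mat_of_cols d vs) UNIV J) = 1"
    unfolding submatrix_eq_mat_of_cols[OF A J(1,2)] picked by (rule J(3))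
  then show "J \<in> unit_minors (mat_of_cols d vs)"
    using J A vs by (simp add: unit_minors_def)
qed

section \<open>Unit simplices\<close>

text \<open>
  Negating the first row exchanges the minors equal to \<open>1\<close> and those equal to \<open>-1\<close>.
\<close>

definition negate_first :: "nat \<Rightarrow> real vec \<Rightarrow> real vec" where
  "negate_first d v = vec d (\<lambda>i. if i = 0 then - v $ i else v $ i)"

lemma inj_negate_first: "inj_on (negate_first d) (carrier_vec d)"
proof (rule inj_onI)
  fix v w :: "real vec" assume vw: "v \<in> carrier_vec d" "w \<in> carrier_vec d" and eq: "negate_first d v = negate_first d w"
  show "v = w"
  proof (rule eq_vecI)
    show "dim_vec v = dim_vec w" using vw by auto
    fix i assume "i < dim_vec w"
    then have "i < d" using vw by auto
    then show "v $ i = w $ i"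
      using arg_cong[OF eq, of "\<lambda>x. x $ i"] by (auto simp: negate_first_def split: if_splits)
  qed
qed

lemma det_negate_first:
  assumes d: "d > 0" and len: "length xs = d"
  shows "det (mat_of_cols d (map (negate_first d) xs)) = - det (mat_of_cols d xs)"
proof -
  have "mat_of_cols d (map (negate_first d) xs) = multrow 0 (-1) (mat_of_cols d xs)"
    using len by (intro eq_matI) (auto simp: mat_of_cols_def negate_first_def)
  then show ?thesis using det_multrow[of 0 d "mat_of_cols d xs" "-1"] d len by auto
qed

lemma negated_columns:
  assumes "set vs \<subseteq> carrier_vec d" "distinct vs"
  shows "set (map (negate_first d) vs) \<subseteq> carrier_vec d" "distinct (map (negate_first d) vs)"
proof -
  show "set (map (negate_first d) vs) \<subseteq> carrier_vec d" by (auto simp: negate_first_def)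
  show "distinct (map (negate_first d) vs)"
    using assms inj_on_subset[OF inj_negate_first] by (simp add: distinct_map)
qed

lemma difference_columns:
  fixes qs :: "real vec list"
  assumes qs: "set qs \<subseteq> carrier_vec d" "distinct qs" and p: "p \<in> carrier_vec d"
  shows "set (map (\<lambda>q. q - p) qs) \<subseteq> carrier_vec d" "distinct (map (\<lambda>q. q - p) qs)"
proof -
  have "inj_on (\<lambda>q. q - p) (carrier_vec d)"
  proof (rule inj_onI)
    fix a b :: "real vec" assume ab: "a \<in> carrier_vec d" "b \<in> carrier_vec d" "a - p = b - p"
    show "a = b"
    proof (rule eq_vecI)
      show "dim_vec a = dim_vec b" using ab by auto
      fix i assume i: "i < dim_vec b"
      have "dim_vec b = d" "dim_vec p = d" using ab p by auto
      then have "a $ i - p $ i = b $ i - p $ i"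
        using arg_cong[OF ab(3), of "\<lambda>x. x $ i"] i by simp
      then show "a $ i = b $ i" by simp
    qed
  qed
  then show "distinct (map (\<lambda>q. q - p) qs)" using qs inj_on_subset by (auto simp: distinct_map)
  have "q - p \<in> carrier_vec d" if "q \<in> set qs" for q
    using that qs p by (meson minus_carrier_vec subsetD)
  then show "set (map (\<lambda>q. q - p) qs) \<subseteq> carrier_vec d" by auto
qed

text \<open>
  Moving a vertex \<open>p\<close> of the simplex to the origin, the other vertices select columns of the
  matrix of all differences \<open>q - p\<close>. Their order in the matrix affects only the sign of the minor.
\<close>

lemma unit_simplex_from_minor:
  fixes qs :: "real vec list"
  assumes d: "d > 0" and qs: "set qs \<subseteq> carrier_vec d" "distinct qs" "length qs = n"
    and T: "T \<in> unit_simplices d (set qs)"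
  shows "\<exists>p\<in>set qs. \<exists>J \<in> unit_minors (mat_of_cols d (map (\<lambda>q. q - p) qs)) \<union>
      unit_minors (mat_of_cols d (map (negate_first d) (map (\<lambda>q. q - p) qs))).
    T = insert p ((!) qs ` J)"
proof -
  from T obtain ps where T': "T \<subseteq> set qs" "card T = d + 1" and ps: "distinct ps" "set ps = T"
    and vol: "simplex_volume d ps = 1"
    by (auto simp: unit_simplices_def)
  have lenps: "length ps = d + 1" using T' ps distinct_card by metis
  define p where "p = hd ps"
  obtain ts where pts: "ps = p # ts" using lenps by (cases ps) (auto simp: p_def)
  have ts: "distinct ts" "p \<notin> set ts" "T = insert p (set ts)" "length ts = d" using ps pts lenps by auto
  have p: "p \<in> set qs" using ts T' by auto
  have diff: "map (\<lambda>q. q - p) qs ! j = qs ! j - p" if "j < n" for j using that qs by simp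
  have pd: "p \<in> carrier_vec d" using p qs by blast
  note carr = difference_columns(1)[OF qs(1,2) pd] and dqs = difference_columns(2)[OF qs(1,2) pd]
  define J where "J = {j. j < n \<and> qs ! j \<in> set ts}"
  have J: "J \<subseteq> {..<n}" by (auto simp: J_def)
  have Jts: "(!) qs ` J = set ts"
  proof
    show "set ts \<subseteq> (!) qs ` J"
    proof
      fix t assume t: "t \<in> set ts"
      then have "t \<in> set qs" using ts T' by auto
      then obtain j where "j < n" "qs ! j = t" using qs by (auto simp: in_set_conv_nth)
      then show "t \<in> (!) qs ` J" using t by (auto simp: J_def)
    qed
  qed (auto simp: J_def)
  have "inj_on ((!) qs) J" using J qs by (intro inj_on_nth) auto
  then have cardJ: "card J = d" using Jts ts distinct_card card_image by metis
  have finJ: "finite J" using J finite_subset by blast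
  let ?xs = "map (\<lambda>j. map (\<lambda>q. q - p) qs ! pick J j) [0..<d]"
  have "set ?xs = (!) (map (\<lambda>q. q - p) qs) ` J" by (rule set_picked_columns[OF finJ cardJ])
  also have "\<dots> = (\<lambda>q. q - p) ` (!) qs ` J"
    unfolding image_image using J diff by (intro image_cong) auto
  also have "\<dots> = set (map (\<lambda>q. q - p) ts)" unfolding Jts by simp
  finally have set_xs: "set ?xs = set (map (\<lambda>q. q - p) ts)" .
  have "set ts \<subseteq> carrier_vec d" using ts T' qs by blast
  then have dts: "distinct (map (\<lambda>q. q - p) ts)" using ts pd by (intro difference_columns(2))
  have "card (set ?xs) = length ?xs" unfolding set_xs using distinct_card[OF dts] ts by simp
  then have "distinct ?xs" by (rule card_distinct)
  then have "mset ?xs = mset (map (\<lambda>q. q - p) ts)"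
    using set_eq_iff_mset_eq_distinct[OF _ dts] set_xs by blast
  then have "\<bar>det (mat_of_cols d ?xs)\<bar> = \<bar>det (mat_of_cols d (map (\<lambda>q. q - p) ts))\<bar>"
    by (intro abs_det_mat_of_cols_permute) simp
  also have "\<dots> = 1" using vol by (simp add: simplex_volume_def pts)
  finally have "det (mat_of_cols d ?xs) = 1 \<or> det (mat_of_cols d ?xs) = -1" by linarith
  then have "J \<in> unit_minors (mat_of_cols d (map (\<lambda>q. q - p) qs)) \<union>
      unit_minors (mat_of_cols d (map (negate_first d) (map (\<lambda>q. q - p) qs)))"
  proof (elim disjE)
    assume "det (mat_of_cols d ?xs) = 1"
    then have "J \<in> unit_minors (mat_of_cols d (map (\<lambda>q. q - p) qs))"
      by (rule unit_minors_of_columns(3)[OF carr dqs _ J cardJ, rotated]) (simp add: qs)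
    then show ?thesis by blast
  next
    assume m1: "det (mat_of_cols d ?xs) = -1"
    have picked: "map (\<lambda>j. map (negate_first d) (map (\<lambda>q. q - p) qs) ! pick J j) [0..<d]
        = map (negate_first d) ?xs"
    proof (rule nth_equalityI)
      fix j assume "j < length (map (\<lambda>j. map (negate_first d) (map (\<lambda>q. q - p) qs) ! pick J j) [0..<d])"
      then have j: "j < d" by simp
      then have "pick J j < n" using pick_in_set_le[of j J] J cardJ by auto
      then show "map (\<lambda>j. map (negate_first d) (map (\<lambda>q. q - p) qs) ! pick J j) [0..<d] ! j
          = map (negate_first d) ?xs ! j"
        using j qs by simp
    qed simp
    have "length ?xs = d" by simp
    from det_negate_first[OF d this] have "det (mat_of_cols d
        (map (\<lambda>j. map (negate_first d) (map (\<lambda>q. q - p) qs) ! pick J j) [0..<d])) = 1"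
      unfolding picked m1 by simp
    then have "J \<in> unit_minors (mat_of_cols d (map (negate_first d) (map (\<lambda>q. q - p) qs)))"
      by (rule unit_minors_of_columns(3)[OF negated_columns[OF carr dqs] _ J cardJ, rotated]) (simp add: qs)
    then show ?thesis by blast
  qed
  moreover have "T = insert p ((!) qs ` J)" using Jts ts by simp
  ultimately show ?thesis using p by blast
qed

text \<open>
  Every point \<open>p\<close> has two matrices, one for each sign of the determinant. The difference \<open>p - p = 0\<close> is
  kept as a column, so that both matrices have exactly \<open>n\<close> columns.
\<close>

lemma max_unit_simplices_le:
  assumes d: "d > 0"
  shows "max_unit_simplices d n \<le> 2 * (n * max_unit_minors d n)"
proof -
  have "max_unit_simplices d n
      \<in> {card (unit_simplices d P) | P. P \<subseteq> carrier_vec d \<and> finite P \<and> card P = n}"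
    unfolding max_unit_simplices_def
    by (rule Max_in[OF max_unit_simplices_finite max_unit_simplices_nonempty[OF d]])
  then obtain P where P: "P \<subseteq> carrier_vec d" "finite P" "card P = n"
    and max: "max_unit_simplices d n = card (unit_simplices d P)" by blast
  obtain qs where qs: "set qs = P" "distinct qs" using finite_distinct_list[OF P(2)] by blast
  have len: "length qs = n" using qs P distinct_card by metis
  define M where "M p = unit_minors (mat_of_cols d (map (\<lambda>q. q - p) qs)) \<union>
      unit_minors (mat_of_cols d (map (negate_first d) (map (\<lambda>q. q - p) qs)))" for p
  have M: "finite (M p)" "card (M p) \<le> 2 * max_unit_minors d n" if p: "p \<in> P" for p
  proof -
    have "set qs \<subseteq> carrier_vec d" "p \<in> carrier_vec d" using qs P p by auto
    note cols = difference_columns[OF this(1) qs(2) this(2)]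
    note plus = unit_minors_of_columns(1,2)[OF cols, of n]
      and minus = unit_minors_of_columns(1,2)[OF negated_columns[OF cols], of n]
    show "finite (M p)" unfolding M_def using plus(1) minus(1) len by simp
    have "card (M p) \<le> card (unit_minors (mat_of_cols d (map (\<lambda>q. q - p) qs))) +
        card (unit_minors (mat_of_cols d (map (negate_first d) (map (\<lambda>q. q - p) qs))))"
      unfolding M_def by (rule card_Un_le)
    also have "\<dots> \<le> max_unit_minors d n + max_unit_minors d n"
      using plus(2) minus(2) len by (intro add_mono) simp_all
    finally show "card (M p) \<le> 2 * max_unit_minors d n" by simp
  qed
  have "unit_simplices d P \<subseteq> (\<Union>p\<in>P. (\<lambda>J. insert p ((!) qs ` J)) ` M p)"
    using unit_simplex_from_minor[OF d, of qs n] qs P len unfolding M_def by blast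
  then have "card (unit_simplices d P) \<le> card (\<Union>p\<in>P. (\<lambda>J. insert p ((!) qs ` J)) ` M p)"
    using P M by (intro card_mono) auto
  also have "\<dots> \<le> (\<Sum>p\<in>P. card ((\<lambda>J. insert p ((!) qs ` J)) ` M p))" using P by (intro card_UN_le)
  also have "\<dots> \<le> (\<Sum>p\<in>P. 2 * max_unit_minors d n)"
    using M card_image_le order_trans by (intro sum_mono) blast
  finally show ?thesis using max P by simp
qed

section \<open>The bounds\<close>

text \<open>
  After clearing denominators this rests on \<open>(d - 1) (d - 2) \<ge> 0\<close> for positive integers \<open>d\<close>.
\<close>

lemma exponent_comparison:
  assumes d: "d > 0" and eps: "\<epsilon> > 0"
  shows "1 + (real d - 2 / (real d + 1))
    \<le> real d + 1 - real d / ((real d)\<^sup>2 - real d + 1) + \<epsilon>"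
proof -
  have "(real d - 1) * (real d - 2) \<ge> 0"
  proof (cases "d = 1")
    case False
    then have "real d \<ge> 2" using d by simp
    then show ?thesis by simp
  qed simp
  then have "real d * (real d + 1) \<le> 2 * ((real d)\<^sup>2 - real d + 1)"
    by (simp add: power2_eq_square algebra_simps)
  moreover have pos: "(real d)\<^sup>2 - real d + 1 > 0"
  proof -
    have "real d * real d \<ge> 1 * real d" using d by (intro mult_right_mono) auto
    then show ?thesis by (simp add: power2_eq_square)
  qed
  ultimately have "real d / ((real d)\<^sup>2 - real d + 1) \<le> 2 / (real d + 1)"
    using d by (simp add: divide_le_eq pos_le_divide_eq field_simps)
  then show ?thesis using eps by simp
qed

theorem corollary5p4:
  shows "(\<exists>C. \<forall>d>0. \<forall>n.
            real (max_unit_simplices d n) \<le> C * (real n * real (max_unit_minors d n))) \<and>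
         (\<forall>d>0. \<forall>\<epsilon>>0. \<exists>C. \<forall>n.
            real n * real (max_unit_minors d n)
              \<le> C * real n powr (real d + 1 - real d / ((real d)\<^sup>2 - real d + 1) + \<epsilon>)) \<and>
         (\<forall>d>0. \<forall>\<epsilon>>0. \<exists>C. \<forall>n.
            real (max_unit_simplices d n)
              \<le> C * real n powr (real d + 1 - real d / ((real d)\<^sup>2 - real d + 1) + \<epsilon>))"
proof -
  have simplices: "real (max_unit_simplices d n) \<le> 2 * (real n * real (max_unit_minors d n))"
    if "d > 0" for d n
    using of_nat_mono[OF max_unit_simplices_le[OF that, of n], where 'a = real] by simp
  have minors: "\<exists>C. \<forall>n. real n * real (max_unit_minors d n)
      \<le> C * real n powr (real d + 1 - real d / ((real d)\<^sup>2 - real d + 1) + \<epsilon>)"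
    if d: "d > 0" and eps: "\<epsilon> > 0" for d :: nat and \<epsilon> :: real
  proof -
    obtain C where C: "C \<ge> 0"
      and bound: "\<And>n. real (max_unit_minors d n) \<le> C * real n powr (real d - 2 / (real d + 1))"
      using max_unit_minors_bound[OF d] by blast
    have "real n * real (max_unit_minors d n)
        \<le> C * real n powr (real d + 1 - real d / ((real d)\<^sup>2 - real d + 1) + \<epsilon>)" for n
    proof (cases "n = 0")
      case False
      then have n: "real n \<ge> 1" by simp
      have "real n * real (max_unit_minors d n) \<le> real n * (C * real n powr (real d - 2 / (real d + 1)))"
        by (intro mult_left_mono bound) simp
      also have "\<dots> = C * real n powr (1 + (real d - 2 / (real d + 1)))"
        using n by (simp add: powr_add)
      also have "\<dots> \<le> C * real n powr (real d + 1 - real d / ((real d)\<^sup>2 - real d + 1) + \<epsilon>)"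
        using C n exponent_comparison[OF d eps] by (intro mult_left_mono powr_mono)
      finally show ?thesis .
    qed simp
    then show ?thesis by blast
  qed
  have "\<exists>C. \<forall>n. real (max_unit_simplices d n)
      \<le> C * real n powr (real d + 1 - real d / ((real d)\<^sup>2 - real d + 1) + \<epsilon>)"
    if d: "d > 0" and eps: "\<epsilon> > 0" for d :: nat and \<epsilon> :: real
  proof -
    obtain C where bound: "\<And>n. real n * real (max_unit_minors d n)
        \<le> C * real n powr (real d + 1 - real d / ((real d)\<^sup>2 - real d + 1) + \<epsilon>)"
      using minors[OF d eps] by blast
    have "real (max_unit_simplices d n)
        \<le> (2 * C) * real n powr (real d + 1 - real d / ((real d)\<^sup>2 - real d + 1) + \<epsilon>)" for n
      using simplices[OF d, of n] bound[of n] by linarith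
    then show ?thesis by blast
  qed
  moreover have "\<exists>C. \<forall>d>0. \<forall>n.
      real (max_unit_simplices d n) \<le> C * (real n * real (max_unit_minors d n))"
    using simplices by blast
  ultimately show ?thesis using minors by (intro conjI allI impI)
qed

end
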